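(* Let $(M,g)$ be an $m$-dimensional Riemannian manifold with Ricci curvature $S$, let $f$ be a smooth function on $M$, let $\xi:=\operatorname{grad}(f)$, and let $\eta$ be the $g$-dual $1$-form of $\xi$ (so $\eta=df$). Let $\lambda,\mu$ be real constants and suppose that $(g,\xi,\lambda,\mu)$ is a gradient $\eta$-Ricci soliton on $M$, i.e. $$\mathcal{L}_{\xi}g+2S+2\lambda g+2\mu\,\eta\otimes\eta=0.$$ Then $$\frac{1}{2}(\Delta-\nabla_{\xi})(|\xi|^2)=|\operatorname{Hess}(f)|^2+\lambda|\xi|^2+\mu|\xi|^2\{|\xi|^2-2\Delta(f)\}.$$
   Context: $\nabla$ is the Levi-Civita connection of $g$, $\mathcal{L}_\xi$ the Lie derivative along $\xi$, $\operatorname{Hess}(f)=\nabla(df)$, and $\Delta=\operatorname{div}\circ\operatorname{grad}$ is the Laplacian of $g$ (so $\Delta(f)=\operatorname{div}(\xi)$). On functions, $\nabla_\xi u=\xi(u)$. $|\xi|^2=g(\xi,\xi)$, and $|\operatorname{Hess}(f)|^2=\sum_{i,j}[\operatorname{Hess}(f)(E_i,E_j)]^2$ for a local orthonormal frame $\{E_i\}$. *)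

theory Defs
  imports "HOL-Analysis.Analysis"
begin

section \<open>Smooth functions on open subsets of Euclidean space\<close>

definition partial_deriv :: "'m::finite \<Rightarrow> (real^'m \<Rightarrow> real) \<Rightarrow> real^'m \<Rightarrow> real"
  where "partial_deriv i f x = frechet_derivative f (at x) (axis i 1)"

text \<open>\<open>Ck_on k U f\<close> is only used for open \<open>U\<close>.\<close>

primrec Ck_on :: "nat \<Rightarrow> (real^'m::finite) set \<Rightarrow> (real^'m \<Rightarrow> real) \<Rightarrow> bool"
  where
    "Ck_on 0 U f \<longleftrightarrow> continuous_on U f"
  | "Ck_on (Suc k) U f \<longleftrightarrow>
       (\<forall>x\<in>U. f differentiable (at x)) \<and> (\<forall>i. Ck_on k U (partial_deriv i f))"

definition Cinf_on :: "(real^'m::finite) set \<Rightarrow> (real^'m \<Rightarrow> real) \<Rightarrow> bool"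
  where "Cinf_on U f \<longleftrightarrow> (\<forall>k. Ck_on k U f)"


section \<open>Smooth manifolds\<close>

text \<open>
  A manifold is given by a smooth atlas \<open>A\<close> (not necessarily maximal) of charts \<open>(U, \<phi>)\<close> on an
  open subset of a Hausdorff second countable space; its points are those covered by the charts.
  Its dimension is \<open>CARD('m)\<close>.
\<close>

type_synonym ('a, 'm) chart = "'a set \<times> ('a \<Rightarrow> real^'m)"

definition is_chart :: "('a::topological_space, 'm::finite) chart \<Rightarrow> bool"
  where "is_chart c \<longleftrightarrow> (case c of (U, \<phi>) \<Rightarrow>
    open U \<and> open (\<phi> ` U) \<and> homeomorphism U (\<phi> ` U) \<phi> (inv_into U \<phi>))"

definition smooth_atlas ::
  "('a::{t2_space,second_countable_topology}, 'm::finite) chart set \<Rightarrow> bool"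
  where "smooth_atlas A \<longleftrightarrow> (\<forall>c\<in>A. is_chart c) \<and>
    (\<forall>(U, \<phi>)\<in>A. \<forall>(V, \<psi>)\<in>A. \<forall>i. Cinf_on (\<phi> ` (U \<inter> V)) (\<lambda>x. \<psi> (inv_into U \<phi> x) $ i))"

definition points :: "('a::topological_space, 'm::finite) chart set \<Rightarrow> 'a set"
  where "points A = (\<Union>(U, \<phi>)\<in>A. U)"

definition smooth_fun_on ::
  "('a::topological_space, 'm::finite) chart set \<Rightarrow> 'a set \<Rightarrow> ('a \<Rightarrow> real) \<Rightarrow> bool"
  where "smooth_fun_on A W u \<longleftrightarrow> open W \<and> W \<subseteq> points A \<and>
    (\<forall>(U, \<phi>)\<in>A. Cinf_on (\<phi> ` (U \<inter> W)) (\<lambda>x. u (inv_into U \<phi> x)))"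

definition smooth_near ::
  "('a::topological_space, 'm::finite) chart set \<Rightarrow> 'a \<Rightarrow> ('a \<Rightarrow> real) \<Rightarrow> bool"
  where "smooth_near A p u \<longleftrightarrow> (\<exists>W. p \<in> W \<and> smooth_fun_on A W u)"


section \<open>Tangent vectors and vector fields\<close>

text \<open>
  A tangent vector at \<open>p\<close> is a directional derivative acting on the functions that are smooth near
  \<open>p\<close>. Functions that are not smooth near \<open>p\<close> are sent to \<open>0\<close>, so that two tangent vectors are equal
  as soon as they agree on the functions smooth near \<open>p\<close>. Vector fields and functions are total;
  only their values on the open set under consideration matter.
\<close>

type_synonym 'a tangent = "('a \<Rightarrow> real) \<Rightarrow> real"
type_synonym 'a vfield = "'a \<Rightarrow> 'a tangent"

definition chart_vec ::
  "('a::topological_space, 'm::finite) chart set \<Rightarrow> ('a, 'm) chart \<Rightarrow> 'a \<Rightarrow> real^'m \<Rightarrow> 'a tangent"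
  where "chart_vec A c p w = (\<lambda>u. if smooth_near A p u
    then frechet_derivative (\<lambda>x. u (inv_into (fst c) (snd c) x)) (at (snd c p)) w else 0)"

definition tangent_space ::
  "('a::topological_space, 'm::finite) chart set \<Rightarrow> 'a \<Rightarrow> 'a tangent set"
  where "tangent_space A p = {chart_vec A c p w | c w. c \<in> A \<and> p \<in> fst c}"

text \<open>The field \<open>\<partial>/\<partial>x\<^sup>i\<close> of a chart.\<close>

definition coord_field ::
  "('a::topological_space, 'm::finite) chart set \<Rightarrow> ('a, 'm) chart \<Rightarrow> 'm \<Rightarrow> 'a vfield"
  where "coord_field A c i = (\<lambda>p. chart_vec A c p (axis i 1))"

definition smooth_vfield_on ::
  "('a::topological_space, 'm::finite) chart set \<Rightarrow> 'a set \<Rightarrow> 'a vfield \<Rightarrow> bool"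
  where "smooth_vfield_on A W X \<longleftrightarrow> open W \<and> W \<subseteq> points A \<and>
    (\<forall>p\<in>W. X p \<in> tangent_space A p) \<and>
    (\<forall>V u. V \<subseteq> W \<and> smooth_fun_on A V u \<longrightarrow> smooth_fun_on A V (\<lambda>p. X p u))"

definition bracket ::
  "('a::topological_space, 'm::finite) chart set \<Rightarrow> 'a vfield \<Rightarrow> 'a vfield \<Rightarrow> 'a vfield"
  where "bracket A X Y = (\<lambda>p u. if smooth_near A p u
    then X p (\<lambda>q. Y q u) - Y p (\<lambda>q. X q u) else 0)"

definition vf_add :: "'a vfield \<Rightarrow> 'a vfield \<Rightarrow> 'a vfield"
  where "vf_add X Y = (\<lambda>p u. X p u + Y p u)"

definition vf_scale :: "('a \<Rightarrow> real) \<Rightarrow> 'a vfield \<Rightarrow> 'a vfield"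
  where "vf_scale h X = (\<lambda>p u. h p * X p u)"


section \<open>Riemannian metrics and the Levi-Civita connection\<close>

type_synonym 'a metric = "'a \<Rightarrow> 'a tangent \<Rightarrow> 'a tangent \<Rightarrow> real"

definition riemannian_metric ::
  "('a::topological_space, 'm::finite) chart set \<Rightarrow> 'a metric \<Rightarrow> bool"
  where "riemannian_metric A g \<longleftrightarrow>
    (\<forall>p\<in>points A. \<forall>v\<in>tangent_space A p. \<forall>w\<in>tangent_space A p.
       g p v w = g p w v \<and>
       (\<forall>z\<in>tangent_space A p. \<forall>a b. g p (\<lambda>u. a * v u + b * w u) z = a * g p v z + b * g p w z) \<and>
       (v \<noteq> (\<lambda>u. 0) \<longrightarrow> g p v v > 0)) \<and>
    (\<forall>W X Y. smooth_vfield_on A W X \<and> smooth_vfield_on A W Y \<longrightarrow>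
       smooth_fun_on A W (\<lambda>p. g p (X p) (Y p)))"

text \<open>
  A connection \<open>D X Y = \<nabla>\<^bsub>X\<^esub> Y\<close> acts on vector fields that are smooth on some open set. Locality in
  both arguments follows from the axioms, since any function vanishing on \<open>W\<close> is smooth on \<open>W\<close>.
\<close>

type_synonym 'a connection = "'a vfield \<Rightarrow> 'a vfield \<Rightarrow> 'a vfield"

definition affine_connection ::
  "('a::topological_space, 'm::finite) chart set \<Rightarrow> 'a connection \<Rightarrow> bool"
  where "affine_connection A D \<longleftrightarrow>
    (\<forall>W X Y Z h. smooth_vfield_on A W X \<and> smooth_vfield_on A W Y \<and> smooth_vfield_on A W Z \<and>
        smooth_fun_on A W h \<longrightarrow>
      smooth_vfield_on A W (D X Y) \<and>
      (\<forall>p\<in>W.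
        D (vf_add X Y) Z p = vf_add (D X Z) (D Y Z) p \<and>
        D (vf_scale h X) Z p = vf_scale h (D X Z) p \<and>
        D X (vf_add Y Z) p = vf_add (D X Y) (D X Z) p \<and>
        D X (vf_scale h Y) p = vf_add (vf_scale (\<lambda>q. X q h) Y) (vf_scale h (D X Y)) p))"

definition torsion_free ::
  "('a::topological_space, 'm::finite) chart set \<Rightarrow> 'a connection \<Rightarrow> bool"
  where "torsion_free A D \<longleftrightarrow>
    (\<forall>W X Y. smooth_vfield_on A W X \<and> smooth_vfield_on A W Y \<longrightarrow>
      (\<forall>p\<in>W. \<forall>u. D X Y p u - D Y X p u = bracket A X Y p u))"

definition metric_compatible ::
  "('a::topological_space, 'm::finite) chart set \<Rightarrow> 'a metric \<Rightarrow> 'a connection \<Rightarrow> bool"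
  where "metric_compatible A g D \<longleftrightarrow>
    (\<forall>W X Y Z. smooth_vfield_on A W X \<and> smooth_vfield_on A W Y \<and> smooth_vfield_on A W Z \<longrightarrow>
      (\<forall>p\<in>W. X p (\<lambda>q. g q (Y q) (Z q)) = g p (D X Y p) (Z p) + g p (Y p) (D X Z p)))"

definition levi_civita ::
  "('a::topological_space, 'm::finite) chart set \<Rightarrow> 'a metric \<Rightarrow> 'a connection \<Rightarrow> bool"
  where "levi_civita A g D \<longleftrightarrow>
    affine_connection A D \<and> torsion_free A D \<and> metric_compatible A g D"


section \<open>Curvature and differential operators\<close>

text \<open>
  The trace at \<open>p\<close> of a function-linear \<open>T\<close>, computed in the basis \<open>\<partial>/\<partial>x\<^sup>i\<close> of a chart around \<open>p\<close>
  with dual basis \<open>dx\<^sup>i(v) = v(x\<^sup>i)\<close>; it does not depend on the chart.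
\<close>

definition trace_at ::
  "('a::topological_space, 'm::finite) chart set \<Rightarrow> 'a \<Rightarrow> ('a vfield \<Rightarrow> 'a tangent) \<Rightarrow> real"
  where "trace_at A p T = (let c = (SOME c. c \<in> A \<and> p \<in> fst c) in
    \<Sum>i\<in>UNIV. T (coord_field A c i) (\<lambda>q. snd c q $ i))"

definition curvature ::
  "('a::topological_space, 'm::finite) chart set \<Rightarrow> 'a connection \<Rightarrow>
    'a vfield \<Rightarrow> 'a vfield \<Rightarrow> 'a vfield \<Rightarrow> 'a vfield"
  where "curvature A D X Y Z =
    (\<lambda>p u. D X (D Y Z) p u - D Y (D X Z) p u - D (bracket A X Y) Z p u)"

definition ricci ::
  "('a::topological_space, 'm::finite) chart set \<Rightarrow> 'a connection \<Rightarrow>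
    'a vfield \<Rightarrow> 'a vfield \<Rightarrow> 'a \<Rightarrow> real"
  where "ricci A D Y Z p = trace_at A p (\<lambda>X. curvature A D X Y Z p)"

definition grad ::
  "('a::topological_space, 'm::finite) chart set \<Rightarrow> 'a metric \<Rightarrow> ('a \<Rightarrow> real) \<Rightarrow> 'a vfield"
  where "grad A g u p =
    (THE v. v \<in> tangent_space A p \<and> (\<forall>w\<in>tangent_space A p. g p v w = w u))"

definition divergence ::
  "('a::topological_space, 'm::finite) chart set \<Rightarrow> 'a connection \<Rightarrow> 'a vfield \<Rightarrow> 'a \<Rightarrow> real"
  where "divergence A D X p = trace_at A p (\<lambda>V. D V X p)"

definition laplacian ::
  "('a::topological_space, 'm::finite) chart set \<Rightarrow> 'a metric \<Rightarrow> 'a connection \<Rightarrow>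
    ('a \<Rightarrow> real) \<Rightarrow> 'a \<Rightarrow> real"
  where "laplacian A g D u = divergence A D (grad A g u)"

type_synonym 'a oneform = "'a \<Rightarrow> 'a tangent \<Rightarrow> real"

definition differential :: "('a \<Rightarrow> real) \<Rightarrow> 'a oneform"
  where "differential u p v = v u"

definition dual_form :: "'a metric \<Rightarrow> 'a vfield \<Rightarrow> 'a oneform"
  where "dual_form g X p v = g p (X p) v"

text \<open>\<open>(\<nabla>\<^bsub>X\<^esub> \<alpha>)(Y)\<close>\<close>

definition cov_deriv_form ::
  "'a connection \<Rightarrow> 'a oneform \<Rightarrow> 'a vfield \<Rightarrow> 'a vfield \<Rightarrow> 'a \<Rightarrow> real"
  where "cov_deriv_form D \<alpha> X Y p = X p (\<lambda>q. \<alpha> q (Y q)) - \<alpha> p (D X Y p)"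

definition hessian ::
  "'a connection \<Rightarrow> ('a \<Rightarrow> real) \<Rightarrow> 'a vfield \<Rightarrow> 'a vfield \<Rightarrow> 'a \<Rightarrow> real"
  where "hessian D u = cov_deriv_form D (differential u)"

definition orthonormal_frame_on ::
  "('a::topological_space, 'm::finite) chart set \<Rightarrow> 'a metric \<Rightarrow> 'a set \<Rightarrow> ('m \<Rightarrow> 'a vfield) \<Rightarrow> bool"
  where "orthonormal_frame_on A g W E \<longleftrightarrow> (\<forall>i. smooth_vfield_on A W (E i)) \<and>
    (\<forall>p\<in>W. \<forall>i j. g p (E i p) (E j p) = (if i = j then 1 else 0))"

text \<open>The value does not depend on the choice of the local orthonormal frame around \<open>p\<close>.\<close>

definition hessian_norm_sq ::
  "('a::topological_space, 'm::finite) chart set \<Rightarrow> 'a metric \<Rightarrow> 'a connection \<Rightarrow>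
    ('a \<Rightarrow> real) \<Rightarrow> 'a \<Rightarrow> real"
  where "hessian_norm_sq A g D u p =
    (let E = (SOME E. \<exists>W. p \<in> W \<and> orthonormal_frame_on A g W E) in
      \<Sum>i\<in>UNIV. \<Sum>j\<in>UNIV. (hessian D u (E i) (E j) p)\<^sup>2)"

definition norm_sq :: "'a metric \<Rightarrow> 'a vfield \<Rightarrow> 'a \<Rightarrow> real"
  where "norm_sq g X p = g p (X p) (X p)"

text \<open>\<open>(\<L>\<^bsub>V\<^esub> g)(X, Y)\<close>\<close>

definition lie_deriv_metric ::
  "('a::topological_space, 'm::finite) chart set \<Rightarrow> 'a metric \<Rightarrow> 'a vfield \<Rightarrow>
    'a vfield \<Rightarrow> 'a vfield \<Rightarrow> 'a \<Rightarrow> real"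
  where "lie_deriv_metric A g V X Y p =
    V p (\<lambda>q. g q (X q) (Y q)) - g p (bracket A V X p) (Y p) - g p (X p) (bracket A V Y p)"

definition eta_ricci_soliton ::
  "('a::topological_space, 'm::finite) chart set \<Rightarrow> 'a metric \<Rightarrow> 'a connection \<Rightarrow>
    'a vfield \<Rightarrow> real \<Rightarrow> real \<Rightarrow> bool"
  where "eta_ricci_soliton A g D V lam mu \<longleftrightarrow>
    (\<forall>W X Y. smooth_vfield_on A W X \<and> smooth_vfield_on A W Y \<longrightarrow>
      (\<forall>p\<in>W. lie_deriv_metric A g V X Y p + 2 * ricci A D X Y p + 2 * lam * g p (X p) (Y p)
        + 2 * mu * dual_form g V p (X p) * dual_form g V p (Y p) = 0))"

end

theory Submission
  imports Defs "HOL-Library.Function_Algebras"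
begin

text \<open>
  Let \<open>S\<close> be the Ricci tensor and \<open>H\<close> the Hessian of \<open>f\<close>. As \<open>\<L>\<^bsub>\<xi>\<^esub> g = 2 H\<close>, the soliton equation reads
  \<open>S = - (H + \<lambda> g + \<mu> \<eta> \<otimes> \<eta>)\<close>. Comparing its trace and its divergence by means of the contracted second
  Bianchi identity \<open>d scal = 2 div S\<close> and of \<open>div H = d (\<Delta> f) + S(\<xi>, -)\<close> gives
  \<open>\<xi>(\<Delta> f) = - 2 S(\<xi>, \<xi>) - 2 \<mu> |\<xi>|\<^sup>2 \<Delta> f\<close>. Substituting this into Bochner's formula
  \<open>1/2 \<Delta> |\<xi>|\<^sup>2 = |H|\<^sup>2 + S(\<xi>, \<xi>) + \<xi>(\<Delta> f)\<close>, eliminating \<open>S(\<xi>, \<xi>)\<close> by the soliton equation and using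
  \<open>H(\<xi>, \<xi>) = 1/2 \<xi>(|\<xi>|\<^sup>2)\<close> yields the claim.

  The tensor calculus is purely algebraic: it takes place in a module of vector fields over a ring of
  functions that has a connection and an orthonormal frame. This module is instantiated on the
  domain of a local orthonormal frame, which the Gram-Schmidt process provides around every point.
\<close>

section \<open>Smooth functions on open subsets of Euclidean space\<close>

text \<open>Fields and functions are total but meaningful only on an open set, so an identity
  between them holds only there. Extension by zero off \<open>W\<close> makes it an honest equation,
  at a price that dictates the axioms of \<open>riemann_alg\<close>: nonzero constant functions do
  not vanish off \<open>W\<close>, so in general they are not members of \<open>F\<close>. Hence
  factors of 2 appear as repeated summands, products of frame fields enter only as functions with
  derivative 0, and \<lambda> and \<mu> become ring elements with derivative 0. The Jacobi identity
  is an axiom there because members of \<open>V\<close> are not assumed to be determined by their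
  action on \<open>F\<close>. No frame that is parallel at a point is constructed. The connection
  coefficients of an arbitrary orthonormal frame are skew, and this makes them drop out of the
  traces.\<close>

lemma frechet_derivative_cong:
  assumes "open U" "x \<in> U" "\<And>y. y \<in> U \<Longrightarrow> f y = g y"
  shows "frechet_derivative f (at x) = frechet_derivative g (at x)"
proof -
  have "(f has_derivative D) (at x) \<longleftrightarrow> (g has_derivative D) (at x)" for D
    by (metis assms has_derivative_transform_within_open)
  then show ?thesis by (simp add: frechet_derivative_def)
qed

lemma partial_deriv_eq:
  assumes "(f has_derivative f') (at x)"
  shows "partial_deriv i f x = f' (axis i 1)"
  using assms unfolding partial_deriv_def by (metis frechet_derivative_at)

lemma partial_deriv_cong:
  assumes "open U" "x \<in> U" "\<And>y. y \<in> U \<Longrightarrow> f y = g y"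
  shows "partial_deriv i f x = partial_deriv i g x"
  using frechet_derivative_cong[OF assms] by (simp add: partial_deriv_def)

lemma differentiable_cong_open:
  assumes "open U" "x \<in> U" "\<And>y. y \<in> U \<Longrightarrow> f y = g y" "f differentiable (at x)"
  shows "g differentiable (at x)"
  using assms unfolding differentiable_def by (metis has_derivative_transform_within_open)

lemma Ck_on_cong:
  assumes "Ck_on k U f" "open U" "\<And>y. y \<in> U \<Longrightarrow> f y = g y"
  shows "Ck_on k U g"
  using assms(1,3)
proof (induction k arbitrary: f g)
  case 0
  then show ?case by (metis Ck_on.simps(1) continuous_on_cong)
next
  case (Suc k)
  have "Ck_on k U (partial_deriv i g)" for i
    by (rule Suc.IH[of "partial_deriv i f"])
       (use Suc.prems partial_deriv_cong[OF assms(2), of _ f g] in auto)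
  then show ?case
    using Suc.prems differentiable_cong_open[OF assms(2), of _ f g] by auto
qed

text \<open>Product and power rules leave undifferentiated factors, whose order must be lowered. The
  recursion asks for continuity only at its last level; above it, differentiability supplies
  continuity.\<close>

lemma Ck_on_Suc: "Ck_on (Suc k) U f \<Longrightarrow> Ck_on k U f"
proof (induction k arbitrary: f)
  case 0
  then show ?case
    by (simp add: continuous_at_imp_continuous_on differentiable_imp_continuous_within)
next
  case (Suc k)
  then show ?case by auto
qed

lemma Ck_on_subset: "Ck_on k U f \<Longrightarrow> V \<subseteq> U \<Longrightarrow> Ck_on k V f"
  by (induction k arbitrary: f) (auto intro: continuous_on_subset)

lemma partial_deriv_const: "partial_deriv i (\<lambda>x. c) = (\<lambda>x. 0)"
  by (rule ext, subst partial_deriv_eq[OF has_derivative_const]) simp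

lemma Ck_on_const: "Ck_on k U (\<lambda>x. c)"
  by (induction k arbitrary: c) (auto simp: partial_deriv_const)

lemma Ck_on_add:
  assumes "open U" "Ck_on k U f" "Ck_on k U g"
  shows "Ck_on k U (\<lambda>x. f x + g x)"
  using assms(2,3)
proof (induction k arbitrary: f g)
  case 0
  then show ?case unfolding Ck_on.simps by (intro continuous_on_add) auto
next
  case (Suc k)
  have eq: "partial_deriv i f x + partial_deriv i g x = partial_deriv i (\<lambda>x. f x + g x) x" if "x \<in> U" for i x
    using Suc.prems that
    by (subst partial_deriv_eq[OF has_derivative_add[OF frechet_derivative_works[THEN iffD1] frechet_derivative_works[THEN iffD1]]])
       (auto simp: partial_deriv_def)
  have "Ck_on k U (partial_deriv i (\<lambda>x. f x + g x))" for i
    using Suc.prems by (intro Ck_on_cong[OF Suc.IH assms(1) eq]) auto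
  then show ?case using Suc.prems by auto
qed

lemma Ck_on_mult:
  assumes "open U" "Ck_on k U f" "Ck_on k U g"
  shows "Ck_on k U (\<lambda>x. f x * g x)"
  using assms(2,3)
proof (induction k arbitrary: f g)
  case 0
  then show ?case unfolding Ck_on.simps by (intro continuous_on_mult) auto
next
  case (Suc k)
  have eq: "f x * partial_deriv i g x + partial_deriv i f x * g x = partial_deriv i (\<lambda>x. f x * g x) x" if "x \<in> U" for i x
  proof -
    have "(f has_derivative frechet_derivative f (at x)) (at x)" "(g has_derivative frechet_derivative g (at x)) (at x)"
      using Suc.prems that by (simp_all flip: frechet_derivative_works)
    from partial_deriv_eq[OF has_derivative_mult[OF this]] show ?thesis
      by (simp add: partial_deriv_def)
  qed
  have "Ck_on k U (\<lambda>x. f x * partial_deriv i g x + partial_deriv i f x * g x)" for i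
    using Suc.prems Ck_on_Suc[OF Suc.prems(1)] Ck_on_Suc[OF Suc.prems(2)]
    by (intro Ck_on_add Suc.IH assms(1)) auto
  then have "Ck_on k U (partial_deriv i (\<lambda>x. f x * g x))" for i
    by (rule Ck_on_cong[OF _ assms(1) eq])
  then show ?case using Suc.prems by (auto intro: differentiable_mult)
qed

lemma Ck_on_sum:
  assumes "open U" "\<And>j. j \<in> J \<Longrightarrow> Ck_on k U (f j)"
  shows "Ck_on k U (\<lambda>x. \<Sum>j\<in>J. f j x)"
  using assms(2)
proof (induction J rule: infinite_finite_induct)
  case (insert j J)
  then show ?case using Ck_on_add[OF assms(1), of k "f j" "\<lambda>x. \<Sum>j\<in>J. f j x"] by simp
qed (simp_all add: Ck_on_const)

lemma differentiable_vec:
  fixes T :: "real^'m::finite \<Rightarrow> real^'n::finite"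
  assumes "\<And>j. (\<lambda>x. T x $ j) differentiable (at x)"
  shows "(T has_derivative (\<lambda>h. \<chi> j. frechet_derivative (\<lambda>x. T x $ j) (at x) h)) (at x)"
proof (subst has_derivative_componentwise_within, intro ballI)
  fix b :: "real^'n" assume "b \<in> Basis"
  then obtain j where b: "b = axis j 1" by (auto simp: Basis_vec_def)
  show "((\<lambda>x. T x \<bullet> b) has_derivative
      (\<lambda>h. (\<chi> j. frechet_derivative (\<lambda>x. T x $ j) (at x) h) \<bullet> b)) (at x)"
    using frechet_derivative_works[THEN iffD1, OF assms[of j]] by (simp add: b inner_axis)
qed

lemma linear_sum_axis:
  assumes "linear (L :: real^'m::finite \<Rightarrow> real)"
  shows "L w = (\<Sum>i\<in>UNIV. w $ i * L (axis i 1))"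
proof -
  have "L w = L (\<Sum>i\<in>UNIV. w $ i *\<^sub>R axis i 1)"
    by (metis (no_types, lifting) basis_expansion scalar_mult_eq_scaleR sum.cong)
  then show ?thesis by (simp add: linear_sum[OF assms] linear_cmul[OF assms])
qed

text \<open>By the chain rule a partial derivative of \<open>F \<circ> T\<close> is a sum of smooth
  functions times partial derivatives of \<open>F\<close> composed with \<open>T\<close>. As
  \<open>T\<close> is smooth of all orders, only \<open>F\<close> changes in the induction.\<close>

lemma Ck_on_compose:
  fixes T :: "real^'m::finite \<Rightarrow> real^'n::finite"
  assumes "open U" "open V" "\<And>j. Cinf_on U (\<lambda>x. T x $ j)" "T ` U \<subseteq> V" "Ck_on k V F"
  shows "Ck_on k U (\<lambda>x. F (T x))"
  using assms(5)
proof (induction k arbitrary: F)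
  case 0
  have "(\<lambda>x. T x $ j) differentiable (at x)" if "x \<in> U" for j x
    using assms(3)[of j] that unfolding Cinf_on_def by (metis Ck_on.simps(2))
  then have "continuous_on U T"
    by (intro continuous_at_imp_continuous_on ballI has_derivative_continuous[OF differentiable_vec])
  then show ?case using 0 assms(4) by (auto intro: continuous_on_compose2)
next
  case (Suc k)
  have dT: "(\<lambda>x. T x $ j) differentiable (at x)" if "x \<in> U" for j x
    using assms(3)[of j] that unfolding Cinf_on_def by (metis Ck_on.simps(2))
  have dF: "F differentiable (at (T x))" if "x \<in> U" for x
    using Suc.prems that assms(4) by auto
  have der: "((\<lambda>x. F (T x)) has_derivative (\<lambda>h. frechet_derivative F (at (T x)) (\<chi> j. frechet_derivative (\<lambda>x. T x $ j) (at x) h))) (at x)"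
    if "x \<in> U" for x
    by (rule has_derivative_compose[OF differentiable_vec[OF dT[OF that]] frechet_derivative_works[THEN iffD1, OF dF[OF that]]])
  have eq: "(\<Sum>j\<in>UNIV. partial_deriv i (\<lambda>x. T x $ j) x * partial_deriv j F (T x)) = partial_deriv i (\<lambda>x. F (T x)) x"
    if "x \<in> U" for i x
    by (subst partial_deriv_eq[OF der[OF that]], subst linear_sum_axis)
       (auto simp: partial_deriv_def dF that intro: linear_frechet_derivative)
  have "Ck_on k U (partial_deriv i (\<lambda>x. T x $ j))" for i j
    using assms(3)[of j] unfolding Cinf_on_def by (metis Ck_on.simps(2))
  then have "Ck_on k U (\<lambda>x. \<Sum>j\<in>UNIV. partial_deriv i (\<lambda>x. T x $ j) x * partial_deriv j F (T x))" for i
    using Suc.prems by (intro Ck_on_sum Ck_on_mult Suc.IH assms(1)) auto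
  then have "Ck_on k U (partial_deriv i (\<lambda>x. F (T x)))" for i
    by (rule Ck_on_cong[OF _ assms(1) eq])
  then show ?case using der by (auto simp: differentiable_def)
qed

text \<open>Differentiation lowers the exponent by 1, so the induction runs over all exponents at
  once. The exponent -1/2 is the one that normalises vector fields below.\<close>

lemma Ck_on_powr:
  assumes "open U" "Ck_on k U f" "\<And>x. x \<in> U \<Longrightarrow> f x > 0"
  shows "Ck_on k U (\<lambda>x. f x powr a)"
  using assms(2)
proof (induction k arbitrary: a)
  case 0
  have "\<forall>x\<in>U. f x \<noteq> 0" using assms(3) by fastforce
  with 0 show ?case unfolding Ck_on.simps by (intro continuous_on_powr continuous_on_const) auto
next
  case (Suc k)
  have der: "((\<lambda>x. f x powr a) has_derivative
      (\<lambda>h. a * f x powr (a - 1) * frechet_derivative f (at x) h)) (at x)" if "x \<in> U" for x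
  proof -
    have "((\<lambda>t. t powr a) has_derivative (\<lambda>h. a * f x powr (a - 1) * h)) (at (f x))"
      using has_real_derivative_powr[OF assms(3)[OF that], of a]
      by (simp add: has_field_derivative_def)
    then show ?thesis
      by (rule has_derivative_compose[rotated]) (use Suc.prems that in \<open>simp flip: frechet_derivative_works\<close>)
  qed
  have eq: "a * f x powr (a - 1) * partial_deriv i f x = partial_deriv i (\<lambda>x. f x powr a) x" if "x \<in> U" for i x
    by (subst partial_deriv_eq[OF der[OF that]]) (simp add: partial_deriv_def)
  have "Ck_on k U (\<lambda>x. a * f x powr (a - 1) * partial_deriv i f x)" for i
    using Suc.prems Ck_on_Suc[OF Suc.prems]
    by (intro Ck_on_mult Ck_on_const Suc.IH assms(1)) auto
  then have "Ck_on k U (partial_deriv i (\<lambda>x. f x powr a))" for i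
    by (rule Ck_on_cong[OF _ assms(1) eq])
  then show ?case using der by (auto simp: differentiable_def)
qed

lemma Cinf_on_differentiable: "Cinf_on U f \<Longrightarrow> x \<in> U \<Longrightarrow> f differentiable (at x)"
  unfolding Cinf_on_def by (metis Ck_on.simps(2))

lemma Cinf_on_partial: "Cinf_on U f \<Longrightarrow> Cinf_on U (partial_deriv i f)"
  unfolding Cinf_on_def by (metis Ck_on.simps(2))

lemma Cinf_on_cong: "Cinf_on U f \<Longrightarrow> open U \<Longrightarrow> (\<And>y. y \<in> U \<Longrightarrow> f y = g y) \<Longrightarrow> Cinf_on U g"
  unfolding Cinf_on_def by (metis Ck_on_cong)

lemma Cinf_on_subset: "Cinf_on U f \<Longrightarrow> V \<subseteq> U \<Longrightarrow> Cinf_on V f"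
  unfolding Cinf_on_def by (metis Ck_on_subset)


section \<open>Tensor calculus in an orthonormal frame\<close>

text \<open>
  \<open>F\<close> plays the role of the functions and \<open>V\<close> of the vector fields, \<open>ap X h\<close> is the derivative \<open>X(h)\<close> and
  \<open>ip\<close> the metric. The Lie bracket is not a primitive: it is \<open>D X Y - D Y X\<close>.
\<close>

locale riemann_alg =
  fixes F :: "'f::comm_ring set" and V :: "'v::ab_group_add set"
    and sc :: "'f \<Rightarrow> 'v \<Rightarrow> 'v" (infixr "\<cdot>" 75)
    and ap :: "'v \<Rightarrow> 'f \<Rightarrow> 'f" and ip :: "'v \<Rightarrow> 'v \<Rightarrow> 'f"
    and D :: "'v \<Rightarrow> 'v \<Rightarrow> 'v" and E :: "'m::finite \<Rightarrow> 'v"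
  assumes F_closed [simp]: "0 \<in> F" "h \<in> F \<Longrightarrow> k \<in> F \<Longrightarrow> h + k \<in> F" "h \<in> F \<Longrightarrow> - h \<in> F"
      "h \<in> F \<Longrightarrow> k \<in> F \<Longrightarrow> h * k \<in> F"
    and V_closed [simp]: "0 \<in> V" "X \<in> V \<Longrightarrow> Y \<in> V \<Longrightarrow> X + Y \<in> V" "X \<in> V \<Longrightarrow> - X \<in> V"
      "h \<in> F \<Longrightarrow> X \<in> V \<Longrightarrow> h \<cdot> X \<in> V" "X \<in> V \<Longrightarrow> Y \<in> V \<Longrightarrow> D X Y \<in> V"
      "E a \<in> V"
    and ap_closed [simp]: "X \<in> V \<Longrightarrow> h \<in> F \<Longrightarrow> ap X h \<in> F"
    and ip_closed [simp]: "X \<in> V \<Longrightarrow> Y \<in> V \<Longrightarrow> ip X Y \<in> F"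
    and sc_add: "h \<cdot> (X + Y) = h \<cdot> X + h \<cdot> Y" "(h + k) \<cdot> X = h \<cdot> X + k \<cdot> X"
    and ap_add: "X \<in> V \<Longrightarrow> Y \<in> V \<Longrightarrow> h \<in> F \<Longrightarrow> ap (X + Y) h = ap X h + ap Y h"
      "X \<in> V \<Longrightarrow> h \<in> F \<Longrightarrow> k \<in> F \<Longrightarrow> ap X (h + k) = ap X h + ap X k"
    and ap_mult: "X \<in> V \<Longrightarrow> h \<in> F \<Longrightarrow> k \<in> F \<Longrightarrow> ap X (h * k) = ap X h * k + h * ap X k"
    and ip_sym: "X \<in> V \<Longrightarrow> Y \<in> V \<Longrightarrow> ip X Y = ip Y X"
    and ip_add1: "X \<in> V \<Longrightarrow> Y \<in> V \<Longrightarrow> Z \<in> V \<Longrightarrow> ip (X + Y) Z = ip X Z + ip Y Z"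
    and ip_sc1: "X \<in> V \<Longrightarrow> Y \<in> V \<Longrightarrow> h \<in> F \<Longrightarrow> ip (h \<cdot> X) Y = h * ip X Y"
    and D_add1: "X \<in> V \<Longrightarrow> Y \<in> V \<Longrightarrow> Z \<in> V \<Longrightarrow> D (X + Y) Z = D X Z + D Y Z"
    and D_add2: "X \<in> V \<Longrightarrow> Y \<in> V \<Longrightarrow> Z \<in> V \<Longrightarrow> D X (Y + Z) = D X Y + D X Z"
    and D_sc1: "X \<in> V \<Longrightarrow> Y \<in> V \<Longrightarrow> h \<in> F \<Longrightarrow> D (h \<cdot> X) Y = h \<cdot> D X Y"
    and D_sc2: "X \<in> V \<Longrightarrow> Y \<in> V \<Longrightarrow> h \<in> F \<Longrightarrow> D X (h \<cdot> Y) = ap X h \<cdot> Y + h \<cdot> D X Y"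
    and torsion: "X \<in> V \<Longrightarrow> Y \<in> V \<Longrightarrow> h \<in> F \<Longrightarrow> ap (D X Y - D Y X) h = ap X (ap Y h) - ap Y (ap X h)"
    and jacobi: "X \<in> V \<Longrightarrow> Y \<in> V \<Longrightarrow> Z \<in> V \<Longrightarrow>
      (D X (D Y Z - D Z Y) - D (D Y Z - D Z Y) X) + (D Y (D Z X - D X Z) - D (D Z X - D X Z) Y)
        + (D Z (D X Y - D Y X) - D (D X Y - D Y X) Z) = 0"
    and compat: "X \<in> V \<Longrightarrow> Y \<in> V \<Longrightarrow> Z \<in> V \<Longrightarrow> ap X (ip Y Z) = ip (D X Y) Z + ip Y (D X Z)"
    and frame: "X \<in> V \<Longrightarrow> X = (\<Sum>a\<in>UNIV. ip X (E a) \<cdot> E a)"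
    and frame_const: "X \<in> V \<Longrightarrow> ap X (ip (E a) (E b)) = 0"
begin

section \<open>Closure properties and additive maps on functions and fields\<close>

lemma closed_diff [simp]: "h \<in> F \<Longrightarrow> k \<in> F \<Longrightarrow> h - k \<in> F" "X \<in> V \<Longrightarrow> Y \<in> V \<Longrightarrow> X - Y \<in> V"
  using F_closed(2)[of h "- k"] V_closed(2)[of X "- Y"] by simp_all

lemma closed_sum [simp]:
  "(\<And>a. a \<in> J \<Longrightarrow> h a \<in> F) \<Longrightarrow> sum h J \<in> F" "(\<And>a. a \<in> J \<Longrightarrow> Z a \<in> V) \<Longrightarrow> sum Z J \<in> V"
  by (induction J rule: infinite_finite_induct; simp)+

lemma sc_zero [simp]: "h \<cdot> 0 = 0" "0 \<cdot> X = 0"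
  using sc_add(1)[of h 0 0] sc_add(2)[of 0 0 X] by simp_all

lemma sc_minus [simp]: "h \<cdot> (- X) = - (h \<cdot> X)" "(- h) \<cdot> X = - (h \<cdot> X)"
  using sc_add(1)[of h X "- X"] sc_add(2)[of h "- h" X] by (simp_all add: add_eq_0_iff)

lemma sc_diff: "h \<cdot> (X - Y) = h \<cdot> X - h \<cdot> Y" "(h - k) \<cdot> X = h \<cdot> X - k \<cdot> X"
  using sc_add(1)[of h X "- Y"] sc_add(2)[of h "- k" X] by simp_all

text \<open>The operations are additive only between members of \<open>V\<close>; their rules for 0,
  negation, differences and sums are all instances of this lemma.\<close>

lemma additive_on_V:
  fixes \<phi> :: "'v \<Rightarrow> 'w::ab_group_add"
  assumes "\<And>X Y. X \<in> V \<Longrightarrow> Y \<in> V \<Longrightarrow> \<phi> (X + Y) = \<phi> X + \<phi> Y"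
  shows "\<phi> 0 = 0" "X \<in> V \<Longrightarrow> \<phi> (- X) = - \<phi> X" "X \<in> V \<Longrightarrow> Y \<in> V \<Longrightarrow> \<phi> (X - Y) = \<phi> X - \<phi> Y"
    "(\<And>a. a \<in> J \<Longrightarrow> Z a \<in> V) \<Longrightarrow> \<phi> (sum Z J) = (\<Sum>a\<in>J. \<phi> (Z a))"
proof -
  show zero: "\<phi> 0 = 0" using assms[of 0 0] by simp
  show minus: "\<phi> (- X) = - \<phi> X" if "X \<in> V" for X
    using assms[of X "- X"] that zero by (simp add: add_eq_0_iff)
  show "X \<in> V \<Longrightarrow> Y \<in> V \<Longrightarrow> \<phi> (X - Y) = \<phi> X - \<phi> Y"
    using assms[of X "- Y"] minus by simp
  show "(\<And>a. a \<in> J \<Longrightarrow> Z a \<in> V) \<Longrightarrow> \<phi> (sum Z J) = (\<Sum>a\<in>J. \<phi> (Z a))"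
    by (induction J rule: infinite_finite_induct) (simp_all add: zero assms)
qed

lemma additive_on_F:
  fixes \<phi> :: "'f \<Rightarrow> 'w::ab_group_add"
  assumes "\<And>h k. h \<in> F \<Longrightarrow> k \<in> F \<Longrightarrow> \<phi> (h + k) = \<phi> h + \<phi> k"
  shows "\<phi> 0 = 0" "h \<in> F \<Longrightarrow> \<phi> (- h) = - \<phi> h" "h \<in> F \<Longrightarrow> k \<in> F \<Longrightarrow> \<phi> (h - k) = \<phi> h - \<phi> k"
    "(\<And>a. a \<in> J \<Longrightarrow> u a \<in> F) \<Longrightarrow> \<phi> (sum u J) = (\<Sum>a\<in>J. \<phi> (u a))"
proof -
  show zero: "\<phi> 0 = 0" using assms[of 0 0] by simp
  show minus: "\<phi> (- h) = - \<phi> h" if "h \<in> F" for h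
    using assms[of h "- h"] that zero by (simp add: add_eq_0_iff)
  show "h \<in> F \<Longrightarrow> k \<in> F \<Longrightarrow> \<phi> (h - k) = \<phi> h - \<phi> k"
    using assms[of h "- k"] minus by simp
  show "(\<And>a. a \<in> J \<Longrightarrow> u a \<in> F) \<Longrightarrow> \<phi> (sum u J) = (\<Sum>a\<in>J. \<phi> (u a))"
    by (induction J rule: infinite_finite_induct) (simp_all add: zero assms)
qed

lemma ip_add2: "X \<in> V \<Longrightarrow> Y \<in> V \<Longrightarrow> Z \<in> V \<Longrightarrow> ip Z (X + Y) = ip Z X + ip Z Y"
  by (metis ip_sym ip_add1 V_closed(2))

lemma ip_sc2: "X \<in> V \<Longrightarrow> Y \<in> V \<Longrightarrow> h \<in> F \<Longrightarrow> ip X (h \<cdot> Y) = h * ip X Y"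
  by (metis ip_sym ip_sc1 V_closed(4))

lemma ip_lin:
  assumes [simp]: "Z \<in> V"
  shows ip_diff1: "X \<in> V \<Longrightarrow> Y \<in> V \<Longrightarrow> ip (X - Y) Z = ip X Z - ip Y Z"
    and ip_diff2: "X \<in> V \<Longrightarrow> Y \<in> V \<Longrightarrow> ip Z (X - Y) = ip Z X - ip Z Y"
    and ip_minus1: "X \<in> V \<Longrightarrow> ip (- X) Z = - ip X Z"
    and ip_zero1: "ip 0 Z = 0"
    and ip_sum1: "(\<And>a. a \<in> J \<Longrightarrow> W a \<in> V) \<Longrightarrow> ip (sum W J) Z = (\<Sum>a\<in>J. ip (W a) Z)"
    and ip_sum2: "(\<And>a. a \<in> J \<Longrightarrow> W a \<in> V) \<Longrightarrow> ip Z (sum W J) = (\<Sum>a\<in>J. ip Z (W a))"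
  using additive_on_V[of "\<lambda>X. ip X Z"] additive_on_V(4)[of "\<lambda>X. ip X Z" J W]
    additive_on_V[of "ip Z"] additive_on_V(4)[of "ip Z" J W] by (simp_all add: ip_add1 ip_add2)

lemma D_lin:
  assumes [simp]: "Z \<in> V"
  shows D_diff1: "X \<in> V \<Longrightarrow> Y \<in> V \<Longrightarrow> D (X - Y) Z = D X Z - D Y Z"
    and D_diff2: "X \<in> V \<Longrightarrow> Y \<in> V \<Longrightarrow> D Z (X - Y) = D Z X - D Z Y"
    and D_minus2: "X \<in> V \<Longrightarrow> D Z (- X) = - D Z X"
    and D_zero1: "D 0 Z = 0"
    and "X \<in> V \<Longrightarrow> Y \<in> V \<Longrightarrow> D (X + Y) Z = D X Z + D Y Z"
    and "X \<in> V \<Longrightarrow> Y \<in> V \<Longrightarrow> D Z (X + Y) = D Z X + D Z Y"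
  using additive_on_V[of "\<lambda>X. D X Z"] additive_on_V[of "D Z"] by (simp_all add: D_add1 D_add2)

lemma ap_lin:
  assumes [simp]: "X \<in> V"
  shows ap_diff: "h \<in> F \<Longrightarrow> k \<in> F \<Longrightarrow> ap X (h - k) = ap X h - ap X k"
    and ap_minus: "h \<in> F \<Longrightarrow> ap X (- h) = - ap X h"
    and ap_sum: "(\<And>a. a \<in> J \<Longrightarrow> u a \<in> F) \<Longrightarrow> ap X (sum u J) = (\<Sum>a\<in>J. ap X (u a))"
  using additive_on_F[of "ap X"] additive_on_F(4)[of "ap X" J u] by (simp_all add: ap_add)

section \<open>Curvature and the second Bianchi identity\<close>

definition br :: "'v \<Rightarrow> 'v \<Rightarrow> 'v" where "br X Y = D X Y - D Y X"

definition R :: "'v \<Rightarrow> 'v \<Rightarrow> 'v \<Rightarrow> 'v"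
  where "R X Y Z = D X (D Y Z) - D Y (D X Z) - D (br X Y) Z"

lemma br_closed [simp]: "X \<in> V \<Longrightarrow> Y \<in> V \<Longrightarrow> br X Y \<in> V"
  by (simp add: br_def)

lemma R_closed [simp]: "X \<in> V \<Longrightarrow> Y \<in> V \<Longrightarrow> Z \<in> V \<Longrightarrow> R X Y Z \<in> V"
  by (simp add: R_def)

lemma R_swap: "X \<in> V \<Longrightarrow> Y \<in> V \<Longrightarrow> Z \<in> V \<Longrightarrow> R Y X Z = - R X Y Z"
  by (simp add: R_def br_def D_lin algebra_simps)

lemma R_add1: "X \<in> V \<Longrightarrow> X' \<in> V \<Longrightarrow> Y \<in> V \<Longrightarrow> Z \<in> V \<Longrightarrow> R (X + X') Y Z = R X Y Z + R X' Y Z"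
  by (simp add: R_def br_def D_lin algebra_simps)

lemma R_add2: "X \<in> V \<Longrightarrow> X' \<in> V \<Longrightarrow> Y \<in> V \<Longrightarrow> Z \<in> V \<Longrightarrow> R Y (X + X') Z = R Y X Z + R Y X' Z"
  by (simp add: R_def br_def D_lin algebra_simps)

lemma R_add3: "X \<in> V \<Longrightarrow> X' \<in> V \<Longrightarrow> Y \<in> V \<Longrightarrow> Z \<in> V \<Longrightarrow> R Y Z (X + X') = R Y Z X + R Y Z X'"
  by (simp add: R_def br_def D_lin algebra_simps)

text \<open>Differentiating \<open>h\<close> in \<open>D Y (h \<cdot> D X Z)\<close> produces Y(h)
  times \<open>D X Z\<close>. The bracket [hX, Y] = h[X, Y] - Y(h)X contributes the same term with
  the opposite sign.\<close>

lemma R_sc1: "X \<in> V \<Longrightarrow> Y \<in> V \<Longrightarrow> Z \<in> V \<Longrightarrow> h \<in> F \<Longrightarrow> R (h \<cdot> X) Y Z = h \<cdot> R X Y Z"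
  by (simp add: R_def br_def D_lin D_sc1 D_sc2 sc_add sc_diff algebra_simps)

lemma R_sc2: "X \<in> V \<Longrightarrow> Y \<in> V \<Longrightarrow> Z \<in> V \<Longrightarrow> h \<in> F \<Longrightarrow> R X (h \<cdot> Y) Z = h \<cdot> R X Y Z"
  using R_sc1[of Y X Z h] R_swap[of "h \<cdot> Y" X Z] R_swap[of Y X Z] by simp

text \<open>The second derivatives of \<open>h\<close> that appear combine to X(Y(h)) - Y(X(h)) -
  [X, Y](h), which vanishes by \<open>torsion\<close>.\<close>

lemma R_sc3:
  assumes "X \<in> V" "Y \<in> V" "Z \<in> V" "h \<in> F" shows "R X Y (h \<cdot> Z) = h \<cdot> R X Y Z"
proof -
  have "ap (br X Y) h \<cdot> Z = ap X (ap Y h) \<cdot> Z - ap Y (ap X h) \<cdot> Z"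
    using assms by (simp add: br_def torsion sc_diff)
  then show ?thesis
    using assms by (simp add: R_def D_lin D_sc2 sc_add sc_diff algebra_simps)
qed

text \<open>Second derivatives of the function \<open>ip Z U\<close> commute up to the bracket.
  Expanding both sides by \<open>compat\<close>, the mixed terms are symmetric in X and Y and
  cancel, leaving the two curvature terms.\<close>

lemma R_skew:
  assumes "X \<in> V" "Y \<in> V" "Z \<in> V" "U \<in> V"
  shows "ip (R X Y Z) U = - ip (R X Y U) Z"
proof -
  have 1: "ap X (ap Y (ip Z U)) = ip (D X (D Y Z)) U + ip (D Y Z) (D X U) + ip (D X Z) (D Y U) + ip Z (D X (D Y U))"
    if "X \<in> V" "Y \<in> V" for X Y
    using assms that by (simp add: compat ap_add algebra_simps)
  have "ap (br X Y) (ip Z U) = ap X (ap Y (ip Z U)) - ap Y (ap X (ip Z U))"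
    using assms by (simp add: br_def torsion)
  moreover have "ap (br X Y) (ip Z U) = ip (D (br X Y) Z) U + ip Z (D (br X Y) U)"
    using assms by (simp add: compat)
  ultimately have "ip (R X Y Z) U + ip Z (R X Y U) = 0"
    using assms by (simp add: 1 R_def ip_diff1 ip_diff2 ip_add1 ip_add2 algebra_simps)
  then show ?thesis using assms ip_sym[of Z "R X Y U"] by (simp add: eq_neg_iff_add_eq_0)
qed

definition nablaR :: "'v \<Rightarrow> 'v \<Rightarrow> 'v \<Rightarrow> 'v \<Rightarrow> 'v"
  where "nablaR U X Y Z = D U (R X Y Z) - R (D U X) Y Z - R X (D U Y) Z - R X Y (D U Z)"

text \<open>In the cyclic sum the third-order derivatives cancel, the iterated brackets vanish by
  the Jacobi identity, and the remaining curvature terms, all of the form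
  \<open>R (D _ _) _ Z\<close>, cancel in pairs.\<close>

lemma second_bianchi:
  assumes [simp]: "U \<in> V" "X \<in> V" "Y \<in> V" "Z \<in> V"
  shows "nablaR U X Y Z + nablaR X Y U Z + nablaR Y U X Z = 0"
proof -
  \<comment> \<open>This is the commutator of the operators \<open>D U\<close> and
    \<open>R X Y\<close>; commuting \<open>D U\<close> with \<open>D (br X Y)\<close> is again a
    curvature plus the derivative along a bracket.\<close>
  have comm: "D U (R X Y Z) - R X Y (D U Z) = D U (D X (D Y Z)) - D U (D Y (D X Z)) - D X (D Y (D U Z)) + D Y (D X (D U Z))
    - R U (br X Y) Z - D (br U (br X Y)) Z" if "U \<in> V" "X \<in> V" "Y \<in> V" for U X Y
    using that by (simp add: R_def D_lin)
  have "D (br U (br X Y)) Z + D (br X (br Y U)) Z + D (br Y (br U X)) Z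
      = D (br U (br X Y) + br X (br Y U) + br Y (br U X)) Z"
    by (simp add: D_add1)
  also have "br U (br X Y) + br X (br Y U) + br Y (br U X) = 0"
    unfolding br_def by (rule jacobi) simp_all
  finally have jac: "D (br U (br X Y)) Z + D (br X (br Y U)) Z + D (br Y (br U X)) Z = 0"
    by (simp add: D_zero1)
  \<comment> \<open>The bracket is split into its two covariant derivatives, and these are moved to
    the first slot of \<open>R\<close>, where they meet the correction terms of
    \<open>nablaR\<close>.\<close>
  have Rbr: "R U (br X Y) Z = R (D Y X) U Z - R (D X Y) U Z" if "U \<in> V" "X \<in> V" "Y \<in> V" for U X Y
  proof -
    have "R U (br X Y) Z + R U (D Y X) Z = R U (D X Y) Z"
      using that by (simp flip: R_add2 add: br_def)
    then show ?thesis using that R_swap[of "D Y X" U Z] R_swap[of "D X Y" U Z]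
      by (simp add: algebra_simps)
  qed
  have sw: "R X (D U Y) Z = - R (D U Y) X Z" if "U \<in> V" "X \<in> V" "Y \<in> V" for U X Y
    using that by (simp add: R_swap[of "D U Y" X Z])
  have "nablaR U X Y Z = D U (D X (D Y Z)) - D U (D Y (D X Z)) - D X (D Y (D U Z)) + D Y (D X (D U Z))
    - R (D Y X) U Z + R (D X Y) U Z - D (br U (br X Y)) Z - R (D U X) Y Z + R (D U Y) X Z"
    if "U \<in> V" "X \<in> V" "Y \<in> V" for U X Y
    using comm[OF that] unfolding nablaR_def Rbr[OF that] sw[OF that] by (simp add: algebra_simps)
  then have "nablaR U X Y Z + nablaR X Y U Z + nablaR Y U X Z
      = - (D (br U (br X Y)) Z + D (br X (br Y U)) Z + D (br Y (br U X)) Z)"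
    by simp
  then show ?thesis by (simp add: jac)
qed

text \<open>Parallel transport keeps the frame orthonormal, so covariant derivatives commute with traces.\<close>

lemma trace_nabla:
  fixes T :: "'v \<Rightarrow> 'v \<Rightarrow> 'f"
  assumes U: "U \<in> V"
    and add1: "\<And>X Y Z. X \<in> V \<Longrightarrow> Y \<in> V \<Longrightarrow> Z \<in> V \<Longrightarrow> T (X + Y) Z = T X Z + T Y Z"
    and add2: "\<And>X Y Z. X \<in> V \<Longrightarrow> Y \<in> V \<Longrightarrow> Z \<in> V \<Longrightarrow> T Z (X + Y) = T Z X + T Z Y"
    and sc1: "\<And>X Y h. X \<in> V \<Longrightarrow> Y \<in> V \<Longrightarrow> h \<in> F \<Longrightarrow> T (h \<cdot> X) Y = h * T X Y"
    and sc2: "\<And>X Y h. X \<in> V \<Longrightarrow> Y \<in> V \<Longrightarrow> h \<in> F \<Longrightarrow> T X (h \<cdot> Y) = h * T X Y"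
  shows "(\<Sum>a\<in>UNIV. T (D U (E a)) (E a)) + (\<Sum>a\<in>UNIV. T (E a) (D U (E a))) = 0"
proof -
  define w where "w a b = ip (D U (E a)) (E b)" for a b
  have w [simp]: "w a b \<in> F" for a b using U by (simp add: w_def)
  \<comment> \<open>\<open>w\<close> is the matrix of \<open>D U\<close> in the frame.
    Differentiating the constant products \<open>ip (E a) (E b)\<close> makes it skew, and the two
    sums of the claim differ only by transposing \<open>w\<close>.\<close>
  have skew: "w a b + w b a = 0" for a b
    using frame_const[OF U, of a b] U ip_sym[of "E a" "D U (E b)"] by (simp add: compat w_def)
  have 1: "T (D U (E a)) (E a) = (\<Sum>b\<in>UNIV. w a b * T (E b) (E a))" for a
    using U by (subst frame[of "D U (E a)"])
      (simp_all add: additive_on_V(4)[of "\<lambda>X. T X (E a)"] add1 sc1 w_def)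
  have 2: "T (E a) (D U (E a)) = (\<Sum>b\<in>UNIV. w a b * T (E a) (E b))" for a
    using U by (subst frame[of "D U (E a)"])
      (simp_all add: additive_on_V(4)[of "T (E a)"] add2 sc2 w_def)
  have "(\<Sum>a\<in>UNIV. \<Sum>b\<in>UNIV. w a b * T (E a) (E b)) = (\<Sum>b\<in>UNIV. \<Sum>a\<in>UNIV. w a b * T (E a) (E b))"
    by (rule sum.swap)
  then have "(\<Sum>a\<in>UNIV. T (D U (E a)) (E a)) + (\<Sum>a\<in>UNIV. T (E a) (D U (E a)))
      = (\<Sum>a\<in>UNIV. \<Sum>b\<in>UNIV. (w a b + w b a) * T (E b) (E a))"
    by (simp add: 1 2 distrib_right sum.distrib)
  then show ?thesis by (simp add: skew)
qed

section \<open>Ricci and scalar curvature, and the contracted Bianchi identity\<close>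

definition S :: "'v \<Rightarrow> 'v \<Rightarrow> 'f"
  where "S Y Z = (\<Sum>a\<in>UNIV. ip (R (E a) Y Z) (E a))"

definition nablaS :: "'v \<Rightarrow> 'v \<Rightarrow> 'v \<Rightarrow> 'f"
  where "nablaS U Y Z = ap U (S Y Z) - S (D U Y) Z - S Y (D U Z)"

definition scal :: "'f" where "scal = (\<Sum>b\<in>UNIV. S (E b) (E b))"

lemma S_closed [simp]: "Y \<in> V \<Longrightarrow> Z \<in> V \<Longrightarrow> S Y Z \<in> F"
  by (simp add: S_def)

lemma S_lin:
  "X \<in> V \<Longrightarrow> Y \<in> V \<Longrightarrow> Z \<in> V \<Longrightarrow> S (X + Y) Z = S X Z + S Y Z"
  "X \<in> V \<Longrightarrow> Y \<in> V \<Longrightarrow> Z \<in> V \<Longrightarrow> S Z (X + Y) = S Z X + S Z Y"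
  "X \<in> V \<Longrightarrow> Y \<in> V \<Longrightarrow> h \<in> F \<Longrightarrow> S (h \<cdot> X) Y = h * S X Y"
  "X \<in> V \<Longrightarrow> Y \<in> V \<Longrightarrow> h \<in> F \<Longrightarrow> S X (h \<cdot> Y) = h * S X Y"
  by (simp_all add: S_def R_add2 R_add3 R_sc2 R_sc3 ip_add1 ip_sc1 sum.distrib sum_distrib_left)

text \<open>Expanding both sides, the terms in which \<open>D U\<close> hits a frame field are the
  two sums that cancel in \<open>trace_nabla\<close>, applied to the curvature with \<open>Y\<close>
  and \<open>Z\<close> held fixed.\<close>

lemma trace_nablaR:
  assumes [simp]: "U \<in> V" "Y \<in> V" "Z \<in> V"
  shows "(\<Sum>a\<in>UNIV. ip (nablaR U (E a) Y Z) (E a)) = nablaS U Y Z"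
proof -
  have "(\<Sum>a\<in>UNIV. ip (R (D U (E a)) Y Z) (E a)) + (\<Sum>a\<in>UNIV. ip (R (E a) Y Z) (D U (E a))) = 0"
    by (rule trace_nabla) (simp_all add: R_add1 R_sc1 ip_add1 ip_sc1 ip_add2 ip_sc2)
  moreover have "ip (D U (R (E a) Y Z)) (E a) = ap U (ip (R (E a) Y Z) (E a)) - ip (R (E a) Y Z) (D U (E a))" for a
    by (simp add: compat)
  ultimately show ?thesis
    by (simp add: nablaR_def nablaS_def S_def ap_sum ip_diff1 sum_subtractf add_eq_0_iff)
qed

text \<open>The second Bianchi identity is traced over two pairs of slots. One of its three terms
  becomes the derivative of \<open>scal\<close>, and each of the other two becomes minus the
  divergence of \<open>S\<close>.\<close>

lemma contracted_bianchi:
  assumes [simp]: "U \<in> V"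
  shows "ap U scal = (\<Sum>b\<in>UNIV. nablaS (E b) U (E b)) + (\<Sum>b\<in>UNIV. nablaS (E b) U (E b))"
proof -
  have nR_skew: "ip (nablaR X Y Z Y') Z' = - ip (nablaR X Y Z Z') Y'"
    if [simp]: "X \<in> V" "Y \<in> V" "Z \<in> V" "Y' \<in> V" "Z' \<in> V" for X Y Z Y' Z'
  proof -
    have exp: "ip (nablaR X Y Z Y') Z' = ap X (ip (R Y Z Y') Z') - ip (R Y Z Y') (D X Z')
        - ip (R (D X Y) Z Y') Z' - ip (R Y (D X Z) Y') Z' - ip (R Y Z (D X Y')) Z'"
      if "Y' \<in> V" "Z' \<in> V" for Y' Z'
      using that by (simp add: nablaR_def ip_diff1 compat)
    have 1: "ap X (ip (R Y Z Y') Z') = - ap X (ip (R Y Z Z') Y')"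
      by (subst R_skew) (simp_all add: ap_minus)
    have 2: "ip (R Y Z Y') (D X Z') = - ip (R Y Z (D X Z')) Y'"
      "ip (R (D X Y) Z Y') Z' = - ip (R (D X Y) Z Z') Y'"
      "ip (R Y (D X Z) Y') Z' = - ip (R Y (D X Z) Z') Y'"
      "ip (R Y Z (D X Y')) Z' = - ip (R Y Z Z') (D X Y')"
      by (rule R_skew; simp)+
    show ?thesis
      unfolding exp[OF that(4,5)] exp[OF that(5,4)] 1 2 by simp
  qed
  have nR_swap: "nablaR X Y Z Y' = - nablaR X Z Y Y'" if [simp]: "X \<in> V" "Y \<in> V" "Z \<in> V" "Y' \<in> V" for X Y Z Y'
  proof -
    have "R Z Y Y' = - R Y Z Y'" "R (D X Z) Y Y' = - R Y (D X Z) Y'" "R Z (D X Y) Y' = - R (D X Y) Z Y'"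
      "R Z Y (D X Y') = - R Y Z (D X Y')" "D X (- R Y Z Y') = - D X (R Y Z Y')"
      by (simp_all add: R_swap[of Y Z] R_swap[of Y "D X Z"] R_swap[of "D X Y" Z] R_swap[of Y Z "D X Y'"]
        D_minus2)
    then show ?thesis unfolding nablaR_def by simp
  qed
  have nR_closed [simp]: "nablaR X Y Z Y' \<in> V" if "X \<in> V" "Y \<in> V" "Z \<in> V" "Y' \<in> V" for X Y Z Y'
    using that by (simp add: nablaR_def)
  let ?n = "\<lambda>b. nablaS (E b) U (E b)"
  have "(\<Sum>b\<in>UNIV. S (D U (E b)) (E b)) + (\<Sum>b\<in>UNIV. S (E b) (D U (E b))) = 0"
    by (rule trace_nabla) (simp_all add: S_lin)
  then have t1: "(\<Sum>b\<in>UNIV. \<Sum>a\<in>UNIV. ip (nablaR U (E a) (E b) (E b)) (E a)) = ap U scal"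
    by (simp add: trace_nablaR scal_def nablaS_def ap_sum sum_subtractf sum.distrib add_eq_0_iff algebra_simps)
  \<comment> \<open>An antisymmetry of the curvature, in the last two slots here and in the first
    two for the third term below, brings the traced index to the place that
    \<open>trace_nablaR\<close> expects.\<close>
  have "ip (nablaR (E a) (E b) U (E b)) (E a) = - ip (nablaR (E a) (E b) U (E a)) (E b)" for a b
    by (rule nR_skew) simp_all
  then have t2: "(\<Sum>b\<in>UNIV. \<Sum>a\<in>UNIV. ip (nablaR (E a) (E b) U (E b)) (E a)) = - sum ?n UNIV"
    by (subst sum.swap) (simp add: sum_negf trace_nablaR)
  have "ip (nablaR (E b) U (E a) (E b)) (E a) = - ip (nablaR (E b) (E a) U (E b)) (E a)" for a b
    by (subst nR_swap) (simp_all add: ip_minus1)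
  then have t3: "(\<Sum>b\<in>UNIV. \<Sum>a\<in>UNIV. ip (nablaR (E b) U (E a) (E b)) (E a)) = - sum ?n UNIV"
    by (simp add: sum_negf trace_nablaR)
  have "ip (nablaR U (E a) (E b) (E b)) (E a) + ip (nablaR (E a) (E b) U (E b)) (E a)
      + ip (nablaR (E b) U (E a) (E b)) (E a) = 0" for a b
    by (simp flip: ip_add1 add: second_bianchi ip_zero1)
  then have "(\<Sum>b\<in>UNIV. \<Sum>a\<in>UNIV. ip (nablaR U (E a) (E b) (E b)) (E a) + ip (nablaR (E a) (E b) U (E b)) (E a)
      + ip (nablaR (E b) U (E a) (E b)) (E a)) = 0"
    by simp
  then show ?thesis
    by (simp add: sum.distrib t1 t2 t3 algebra_simps)
qed

section \<open>The divergence of a vector field\<close>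

definition dv :: "'v \<Rightarrow> 'f" where "dv X = (\<Sum>a\<in>UNIV. ip (D (E a) X) (E a))"

lemma dv_closed [simp]: "X \<in> V \<Longrightarrow> dv X \<in> F"
  by (simp add: dv_def)

text \<open>\<open>\<nabla>\<^bsub>U\<^esub> (tr \<nabla>\<xi>) = tr (\<nabla>\<^bsub>U\<^esub> \<nabla>\<xi>)\<close>\<close>

lemma ap_dv:
  assumes [simp]: "U \<in> V" "\<xi> \<in> V"
  shows "ap U (dv \<xi>) = (\<Sum>a\<in>UNIV. ip (D U (D (E a) \<xi>) - D (D U (E a)) \<xi>) (E a))"
proof -
  have "(\<Sum>a\<in>UNIV. ip (D (D U (E a)) \<xi>) (E a)) + (\<Sum>a\<in>UNIV. ip (D (E a) \<xi>) (D U (E a))) = 0"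
    by (rule trace_nabla) (simp_all add: D_add1 D_sc1 ip_add1 ip_sc1 ip_add2 ip_sc2)
  then show ?thesis
    by (simp add: dv_def ap_sum compat ip_diff1 sum_subtractf sum.distrib add_eq_0_iff algebra_simps)
qed

end

text \<open>The potential f does not occur: of a gradient field, the algebra keeps the symmetry of
  its covariant derivative. \<open>soliton\<close> is half of the defining equation, because the Lie
  derivative of the metric is twice the Hessian.\<close>

locale riemann_alg_soliton = riemann_alg +
  fixes \<xi> :: 'b and l m :: 'a
  assumes xi [simp]: "\<xi> \<in> V"
    and sym: "X \<in> V \<Longrightarrow> Y \<in> V \<Longrightarrow> ip (D X \<xi>) Y = ip (D Y \<xi>) X"
    and const: "l \<in> F" "m \<in> F" "X \<in> V \<Longrightarrow> ap X l = 0" "X \<in> V \<Longrightarrow> ap X m = 0"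
    and soliton: "X \<in> V \<Longrightarrow> Y \<in> V \<Longrightarrow>
      ip (D X \<xi>) Y + S X Y + l * ip X Y + m * (ip \<xi> X * ip \<xi> Y) = 0"
begin

abbreviation H :: "'b \<Rightarrow> 'b \<Rightarrow> 'a" where "H X Y \<equiv> ip (D X \<xi>) Y"

lemma expand:
  assumes "X \<in> V" "Y \<in> V" shows "(\<Sum>b\<in>UNIV. H (E b) Y * ip X (E b)) = H X Y"
proof -
  have "H X Y = ip (D Y \<xi>) (\<Sum>b\<in>UNIV. ip X (E b) \<cdot> E b)"
    using sym[OF assms] frame[OF assms(1)] by simp
  also have "\<dots> = (\<Sum>b\<in>UNIV. ip X (E b) * ip (D Y \<xi>) (E b))"
    using assms by (simp add: ip_sum2 ip_sc2)
  finally show ?thesis using assms sym by (simp add: mult.commute)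
qed

text \<open>\<open>D \<xi> \<xi>\<close> is half the gradient of the squared length of \<xi>.
  Exchanging \<open>D (E a)\<close> with \<open>D \<xi>\<close> costs a curvature term whose trace
  is \<open>S \<xi> \<xi>\<close>; the exchanged term traces to the derivative of the divergence by
  \<open>ap_dv\<close>. What is left is the trace of the square of the endomorphism given by D\<xi>,
  a sum of squares by symmetry.\<close>

lemma bochner:
  "dv (D \<xi> \<xi>) = (\<Sum>a\<in>UNIV. \<Sum>b\<in>UNIV. H (E a) (E b) * H (E a) (E b)) + S \<xi> \<xi> + ap \<xi> (dv \<xi>)"
proof -
  have "D (E a) (D \<xi> \<xi>) = R (E a) \<xi> \<xi> + (D \<xi> (D (E a) \<xi>) - D (D \<xi> (E a)) \<xi>) + D (D (E a) \<xi>) \<xi>" for a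
    by (simp add: R_def br_def D_diff1)
  then have "dv (D \<xi> \<xi>) = S \<xi> \<xi> + ap \<xi> (dv \<xi>) + (\<Sum>a\<in>UNIV. H (D (E a) \<xi>) (E a))"
    by (simp add: dv_def[of "D \<xi> \<xi>"] ap_dv S_def ip_add1 sum.distrib)
  moreover have "H (D (E a) \<xi>) (E a) = (\<Sum>b\<in>UNIV. H (E a) (E b) * H (E a) (E b))" for a
    using expand[of "D (E a) \<xi>" "E a"] sym[of "E a"] by simp
  ultimately show ?thesis by (simp add: algebra_simps)
qed

lemma S_eq: "X \<in> V \<Longrightarrow> Y \<in> V \<Longrightarrow> S X Y = - (H X Y + l * ip X Y + m * (ip \<xi> X * ip \<xi> Y))"
  using soliton[of X Y] by (simp add: eq_neg_iff_add_eq_0 algebra_simps)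

text \<open>The metric and the constants are parallel, so only the Hessian and the term with \<mu>
  survive. The first summand is the covariant derivative of the Hessian.\<close>

lemma nablaS_eq:
  assumes [simp]: "U \<in> V" "X \<in> V" "Y \<in> V"
  shows "nablaS U X Y = - (ip (D U (D X \<xi>) - D (D U X) \<xi>) Y + m * (H U X * ip \<xi> Y + ip \<xi> X * H U Y))"
  by (simp add: nablaS_def S_eq ap_minus ap_diff ap_add ap_mult const compat ip_diff1 ip_add1 algebra_simps)

text \<open>The derivative of the divergence enters the trace side of the contracted Bianchi
  identity once and the other side twice, so the identity can be solved for it. The Hessian terms
  with \<mu> occur twice on either side and cancel.\<close>

lemma ap_dv_soliton:
  assumes [simp]: "U \<in> V"
  shows "ap U (dv \<xi>) + (S U \<xi> + S U \<xi>) + m * (ip \<xi> U * dv \<xi> + ip \<xi> U * dv \<xi>) = 0"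
proof -
  \<comment> \<open>This Ricci identity moves the traced derivative next to \<xi>, so that
    \<open>ap_dv\<close> applies. The trace of its curvature term is
    \<open>S U \<xi>\<close>.\<close>
  have 0: "D (E b) (D U \<xi>) - D (D (E b) U) \<xi> = (D U (D (E b) \<xi>) - D (D U (E b)) \<xi>) + R (E b) U \<xi>" for b
    by (simp add: R_def br_def D_diff1)
  have 1: "(\<Sum>b\<in>UNIV. nablaS (E b) U (E b)) = - (ap U (dv \<xi>) + S U \<xi> + m * (H \<xi> U + ip \<xi> U * dv \<xi>))"
  proof -
    have "nablaS (E b) U (E b) = - (ip (D U (D (E b) \<xi>) - D (D U (E b)) \<xi>) (E b) + ip (R (E b) U \<xi>) (E b)
        + m * (H (E b) U * ip \<xi> (E b) + ip \<xi> U * H (E b) (E b)))" for b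
      using 0 by (simp add: nablaS_eq ip_add1)
    moreover have dv: "(\<Sum>b\<in>UNIV. H (E b) (E b)) = dv \<xi>" by (simp add: dv_def)
    ultimately show ?thesis
      by (simp add: sum_negf sum_subtractf sum.distrib ap_dv S_def expand dv flip: sum_distrib_left)
  qed
  \<comment> \<open>\<open>n\<close> stands for the dimension, the trace of the metric. It
    disappears from the derivative of \<open>scal\<close> because its own derivative is 0.\<close>
  define n where "n = (\<Sum>b\<in>UNIV. ip (E b) (E b))"
  have n: "n \<in> F" "ap U n = 0"
    by (simp_all add: n_def ap_sum frame_const)
  have "ip \<xi> \<xi> = (\<Sum>b\<in>UNIV. ip \<xi> (E b) * ip \<xi> (E b))"
  proof -
    have "ip \<xi> \<xi> = ip (\<Sum>b\<in>UNIV. ip \<xi> (E b) \<cdot> E b) \<xi>" using frame[of \<xi>] by simp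
    also have "\<dots> = (\<Sum>b\<in>UNIV. ip \<xi> (E b) * ip \<xi> (E b))"
      by (simp add: ip_sum1 ip_sc1 ip_sym[of "E _" \<xi>])
    finally show ?thesis .
  qed
  then have "scal = - (dv \<xi> + l * n + m * ip \<xi> \<xi>)"
    by (simp add: scal_def S_eq n_def sum_negf sum.distrib sum_subtractf sum_distrib_left dv_def)
  then have 2: "ap U scal = - (ap U (dv \<xi>) + m * (H U \<xi> + H U \<xi>))"
    using n ip_sym[of \<xi> "D U \<xi>"] by (simp add: ap_minus ap_diff ap_add ap_mult const compat)
  have "- (ap U (dv \<xi>) + m * (H U \<xi> + H U \<xi>))
      = - (ap U (dv \<xi>) + S U \<xi> + m * (H U \<xi> + ip \<xi> U * dv \<xi>))
        - (ap U (dv \<xi>) + S U \<xi> + m * (H U \<xi> + ip \<xi> U * dv \<xi>))"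
    using contracted_bianchi[of U] unfolding 1 2 sym[OF xi assms] by simp
  from arg_cong[OF this, of uminus] have "ap U (dv \<xi>) + m * (H U \<xi> + H U \<xi>)
      = (ap U (dv \<xi>) + S U \<xi> + m * (H U \<xi> + ip \<xi> U * dv \<xi>))
        + (ap U (dv \<xi>) + S U \<xi> + m * (H U \<xi> + ip \<xi> U * dv \<xi>))"
    by (simp only: minus_minus minus_diff_eq diff_minus_eq_add)
  then show ?thesis by (simp add: algebra_simps)
qed

text \<open>\<open>bochner\<close> contributes \<open>S \<xi> \<xi>\<close> once, and
  \<open>ap_dv_soliton\<close> contributes it twice with the opposite sign. The remaining - S(\<xi>,
  \<xi>) yields, through the soliton equation, the Hessian term on the left and the terms with
  \<lambda> and the fourth power of the length.\<close>

theorem soliton_identity: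
  "dv (D \<xi> \<xi>) - H \<xi> \<xi> = (\<Sum>a\<in>UNIV. \<Sum>b\<in>UNIV. H (E a) (E b) * H (E a) (E b)) + l * ip \<xi> \<xi>
     + m * (ip \<xi> \<xi> * ip \<xi> \<xi>) - m * (ip \<xi> \<xi> * dv \<xi> + ip \<xi> \<xi> * dv \<xi>)"
proof -
  have 1: "ap \<xi> (dv \<xi>) = - (S \<xi> \<xi> + S \<xi> \<xi>) - m * (ip \<xi> \<xi> * dv \<xi> + ip \<xi> \<xi> * dv \<xi>)"
    using ap_dv_soliton[of \<xi>] by (simp add: eq_diff_eq eq_neg_iff_add_eq_0 ac_simps)
  show ?thesis unfolding bochner 1 by (simp add: S_eq)
qed

end


section \<open>Tangent vectors and vector fields\<close>

locale smooth_manifold =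
  fixes A :: "('a::{t2_space,second_countable_topology}, 'm::finite) chart set"
  assumes atlas: "smooth_atlas A"
begin

section \<open>Charts and their transition maps\<close>

lemma chart:
  assumes "(U, \<phi>) \<in> A"
  shows chart_open: "open U"
    and chart_open_image: "open W \<Longrightarrow> open (\<phi> ` (U \<inter> W))"
    and chart_inv: "q \<in> U \<Longrightarrow> inv_into U \<phi> (\<phi> q) = q"
proof -
  have c: "open U" "open (\<phi> ` U)" "homeomorphism U (\<phi> ` U) \<phi> (inv_into U \<phi>)"
    using atlas assms by (auto simp: smooth_atlas_def is_chart_def)
  show "open U" by fact
  show "q \<in> U \<Longrightarrow> inv_into U \<phi> (\<phi> q) = q"
    using c(3) by (simp add: homeomorphism_def)
  assume "open W"
  then have "openin (top_of_set (\<phi> ` U)) (\<phi> ` (U \<inter> W))"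
    by (intro homeomorphism_imp_open_map[OF c(3)]) (simp add: openin_open_Int)
  then show "open (\<phi> ` (U \<inter> W))" using c(2) openin_open_trans by blast
qed

lemma chart_transition:
  assumes "(U, \<phi>) \<in> A" "(V, \<psi>) \<in> A"
  shows "Cinf_on (\<psi> ` (V \<inter> U)) (\<lambda>x. \<phi> (inv_into V \<psi> x) $ i)"
  using atlas assms unfolding smooth_atlas_def by fast

lemma points_chart: "p \<in> points A \<Longrightarrow> (\<And>U \<phi>. (U, \<phi>) \<in> A \<Longrightarrow> p \<in> U \<Longrightarrow> thesis) \<Longrightarrow> thesis"
  by (auto simp: points_def)

lemma some_chart:
  assumes "p \<in> points A"
  shows "(SOME c. c \<in> A \<and> p \<in> fst c) \<in> A" "p \<in> fst (SOME c. c \<in> A \<and> p \<in> fst c)"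
proof -
  obtain U \<phi> where "(U, \<phi>) \<in> A" "p \<in> U" using points_chart[OF assms] .
  then have "\<exists>c. c \<in> A \<and> p \<in> fst c" by (intro exI[of _ "(U, \<phi>)"]) simp
  from someI_ex[OF this] show "(SOME c. c \<in> A \<and> p \<in> fst c) \<in> A" "p \<in> fst (SOME c. c \<in> A \<and> p \<in> fst c)"
    by auto
qed

lemma chart_subset_points: "(U, \<phi>) \<in> A \<Longrightarrow> U \<subseteq> points A"
  by (auto simp: points_def)

section \<open>Smooth functions on open subsets of the manifold\<close>

lemma smooth_fun_onD:
  "smooth_fun_on A W u \<Longrightarrow> (U, \<phi>) \<in> A \<Longrightarrow> Cinf_on (\<phi> ` (U \<inter> W)) (\<lambda>x. u (inv_into U \<phi> x))"
  "smooth_fun_on A W u \<Longrightarrow> open W" "smooth_fun_on A W u \<Longrightarrow> W \<subseteq> points A"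
  unfolding smooth_fun_on_def by fast+

lemma smooth_fun_on_cong:
  assumes "smooth_fun_on A W u" "\<And>q. q \<in> W \<Longrightarrow> u q = u' q"
  shows "smooth_fun_on A W u'"
proof -
  have "Cinf_on (\<phi> ` (U \<inter> W)) (\<lambda>x. u' (inv_into U \<phi> x))" if c: "(U, \<phi>) \<in> A" for U \<phi>
    by (rule Cinf_on_cong[OF smooth_fun_onD(1)[OF assms(1) c]])
       (use c assms smooth_fun_onD(2)[OF assms(1)] in \<open>auto simp: chart_open_image chart_inv\<close>)
  then show ?thesis using assms(1) unfolding smooth_fun_on_def by auto
qed

lemma smooth_fun_on_subset:
  assumes "smooth_fun_on A W u" "open V" "V \<subseteq> W" shows "smooth_fun_on A V u"
proof -
  have "Cinf_on (\<phi> ` (U \<inter> V)) (\<lambda>x. u (inv_into U \<phi> x))" if c: "(U, \<phi>) \<in> A" for U \<phi>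
    by (rule Cinf_on_subset[OF smooth_fun_onD(1)[OF assms(1) c]]) (use assms in auto)
  then show ?thesis using assms unfolding smooth_fun_on_def by auto
qed

lemma smooth_fun_on_combine:
  assumes "smooth_fun_on A W u" "smooth_fun_on A W u'"
    and "\<And>k U f g. open U \<Longrightarrow> Ck_on k U f \<Longrightarrow> Ck_on k U g \<Longrightarrow> Ck_on k U (\<lambda>x::real^'m. h (f x) (g x))"
  shows "smooth_fun_on A W (\<lambda>q. h (u q) (u' q))"
proof -
  have "Cinf_on (\<phi> ` (U \<inter> W)) (\<lambda>x. h (u (inv_into U \<phi> x)) (u' (inv_into U \<phi> x)))"
    if c: "(U, \<phi>) \<in> A" for U \<phi>
    using smooth_fun_onD(1)[OF assms(1) c] smooth_fun_onD(1)[OF assms(2) c]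
      assms(3)[OF chart_open_image[OF c smooth_fun_onD(2)[OF assms(1)]]]
    unfolding Cinf_on_def by blast
  then show ?thesis using assms(1) unfolding smooth_fun_on_def by auto
qed

lemma smooth_fun_on_add: "smooth_fun_on A W u \<Longrightarrow> smooth_fun_on A W u' \<Longrightarrow> smooth_fun_on A W (\<lambda>q. u q + u' q)"
  by (rule smooth_fun_on_combine[where h = "(+)"]) (auto intro: Ck_on_add)

lemma smooth_fun_on_mult: "smooth_fun_on A W u \<Longrightarrow> smooth_fun_on A W u' \<Longrightarrow> smooth_fun_on A W (\<lambda>q. u q * u' q)"
  by (rule smooth_fun_on_combine[where h = "(*)"]) (auto intro: Ck_on_mult)

lemma smooth_fun_on_const: "open W \<Longrightarrow> W \<subseteq> points A \<Longrightarrow> smooth_fun_on A W (\<lambda>q. c)"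
  by (auto simp: smooth_fun_on_def Cinf_on_def Ck_on_const)

lemma smooth_fun_on_uminus: "smooth_fun_on A W u \<Longrightarrow> smooth_fun_on A W (\<lambda>q. - u q)"
  using smooth_fun_on_mult[OF smooth_fun_on_const[of W "-1"], of u] smooth_fun_onD(2,3)[of W u] by simp

lemma smooth_fun_on_powr:
  assumes "smooth_fun_on A W u" "\<And>q. q \<in> W \<Longrightarrow> u q > 0"
  shows "smooth_fun_on A W (\<lambda>q. u q powr a)"
proof -
  have "Cinf_on (\<phi> ` (U \<inter> W)) (\<lambda>x. u (inv_into U \<phi> x) powr a)" if c: "(U, \<phi>) \<in> A" for U \<phi>
  proof -
    have "u (inv_into U \<phi> x) > 0" if "x \<in> \<phi> ` (U \<inter> W)" for x
      using that assms(2) by (auto simp: chart_inv[OF c])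
    then show ?thesis
      using smooth_fun_onD(1)[OF assms(1) c] Ck_on_powr[OF chart_open_image[OF c smooth_fun_onD(2)[OF assms(1)]]]
      unfolding Cinf_on_def by blast
  qed
  then show ?thesis using assms(1) unfolding smooth_fun_on_def by auto
qed

text \<open>Smoothness is demanded in every chart of \<open>A\<close>. The transition maps carry it
  over from a single chart, by \<open>Ck_on_compose\<close>.\<close>

lemma smooth_fun_on_chart:
  assumes "(U, \<phi>) \<in> A" "open V" "V \<subseteq> U" "Cinf_on (\<phi> ` V) F"
  shows "smooth_fun_on A V (\<lambda>q. F (\<phi> q))"
proof -
  have "Cinf_on (\<psi> ` (U' \<inter> V)) (\<lambda>x. F (\<phi> (inv_into U' \<psi> x)))" if c: "(U', \<psi>) \<in> A" for U' \<psi>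
  proof -
    have "open (\<psi> ` (U' \<inter> V))" "open (\<phi> ` V)"
      using chart_open_image[OF c assms(2)] chart_open_image[OF assms(1,2)] assms(3)
      by (simp_all add: Int_absorb1)
    moreover have "Cinf_on (\<psi> ` (U' \<inter> V)) (\<lambda>x. \<phi> (inv_into U' \<psi> x) $ j)" for j
      by (rule Cinf_on_subset[OF chart_transition[OF assms(1) c]]) (use assms in auto)
    moreover have "(\<lambda>x. \<phi> (inv_into U' \<psi> x)) ` (\<psi> ` (U' \<inter> V)) \<subseteq> \<phi> ` V"
      by (auto simp: chart_inv[OF c])
    ultimately show ?thesis
      using assms(4) Ck_on_compose[of "\<psi> ` (U' \<inter> V)" "\<phi> ` V" "\<lambda>x. \<phi> (inv_into U' \<psi> x)"]
      unfolding Cinf_on_def[of _ F] Cinf_on_def[of _ "\<lambda>x. F (\<phi> (inv_into U' \<psi> x))"] by blast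
  qed
  then show ?thesis using assms chart_subset_points[OF assms(1)] by (auto simp: smooth_fun_on_def)
qed

lemma smooth_fun_on_coord:
  assumes "(U, \<phi>) \<in> A" shows "smooth_fun_on A U (\<lambda>q. \<phi> q $ i)"
  using assms chart_open[OF assms] chart_subset_points[OF assms] chart_transition[OF assms]
  by (auto simp: smooth_fun_on_def)

lemma smooth_nearI: "smooth_fun_on A W u \<Longrightarrow> p \<in> W \<Longrightarrow> smooth_near A p u"
  by (auto simp: smooth_near_def)

lemma smooth_near_within:
  assumes "smooth_near A p u" "open V" "p \<in> V"
  obtains W where "p \<in> W" "W \<subseteq> V" "smooth_fun_on A W u"
proof -
  obtain W where W: "p \<in> W" "smooth_fun_on A W u" using assms by (auto simp: smooth_near_def)
  then have "smooth_fun_on A (W \<inter> V) u"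
    using assms by (auto intro: smooth_fun_on_subset smooth_fun_onD)
  then show thesis using that[of "W \<inter> V"] W assms by auto
qed

lemma smooth_near_cong:
  assumes "open V" "p \<in> V" "\<And>q. q \<in> V \<Longrightarrow> u q = u' q"
  shows "smooth_near A p u \<longleftrightarrow> smooth_near A p u'"
proof -
  have "smooth_near A p u'" if "smooth_near A p u" "\<And>q. q \<in> V \<Longrightarrow> u q = u' q" for u u'
    using smooth_near_within[OF that(1) assms(1,2)]
    by (metis that(2) smooth_fun_on_cong smooth_nearI subset_iff)
  then show ?thesis using assms(3) by metis
qed

lemma smooth_near_combine:
  assumes "smooth_near A p u" "smooth_near A p u'"
  obtains W where "p \<in> W" "smooth_fun_on A W u" "smooth_fun_on A W u'"
  using assms smooth_near_within smooth_fun_on_subset smooth_fun_onD(2)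
  by (metis smooth_near_def)

lemma smooth_near_add: "smooth_near A p u \<Longrightarrow> smooth_near A p u' \<Longrightarrow> smooth_near A p (\<lambda>q. u q + u' q)"
  by (erule (1) smooth_near_combine) (metis smooth_fun_on_add smooth_nearI)

lemma smooth_near_mult: "smooth_near A p u \<Longrightarrow> smooth_near A p u' \<Longrightarrow> smooth_near A p (\<lambda>q. u q * u' q)"
  by (erule (1) smooth_near_combine) (metis smooth_fun_on_mult smooth_nearI)

lemma smooth_near_const: "p \<in> points A \<Longrightarrow> smooth_near A p (\<lambda>q. c)"
  by (metis points_chart chart_open chart_subset_points smooth_fun_on_const smooth_nearI)

lemma smooth_near_rep:
  assumes "smooth_near A p u" "(U, \<phi>) \<in> A" "p \<in> U"
  shows "((\<lambda>x. u (inv_into U \<phi> x)) has_derivative frechet_derivative (\<lambda>x. u (inv_into U \<phi> x)) (at (\<phi> p))) (at (\<phi> p))"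
  using assms unfolding smooth_near_def
  by (metis (no_types, lifting) Cinf_on_differentiable smooth_fun_onD(1) IntI imageI frechet_derivative_works)

section \<open>Tangent vectors as derivations\<close>

lemma chart_vec_smooth:
  "smooth_near A p u \<Longrightarrow> chart_vec A (U, \<phi>) p w u = frechet_derivative (\<lambda>x. u (inv_into U \<phi> x)) (at (\<phi> p)) w"
  by (simp add: chart_vec_def)

lemma chart_vec_eq:
  assumes "smooth_near A p u" "((\<lambda>x. u (inv_into U \<phi> x)) has_derivative L) (at (\<phi> p))"
  shows "chart_vec A (U, \<phi>) p w u = L w"
  using assms chart_vec_smooth frechet_derivative_at by metis

lemma chart_vec_in: "(U, \<phi>) \<in> A \<Longrightarrow> p \<in> U \<Longrightarrow> chart_vec A (U, \<phi>) p w \<in> tangent_space A p"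
  unfolding tangent_space_def by (metis (mono_tags, lifting) mem_Collect_eq fst_conv)

lemma tangentE:
  assumes "v \<in> tangent_space A p"
  obtains U \<phi> w where "(U, \<phi>) \<in> A" "p \<in> U" "v = chart_vec A (U, \<phi>) p w"
proof -
  obtain c w where "c \<in> A" "p \<in> fst c" "v = chart_vec A c p w"
    using assms unfolding tangent_space_def by blast
  then show thesis using that[of "fst c" "snd c" w] by simp
qed

lemma tangent_points: "v \<in> tangent_space A p \<Longrightarrow> p \<in> points A"
  by (erule tangentE) (metis chart_subset_points subset_iff)

text \<open>Derivatives are local, and so is \<open>smooth_near\<close>; hence the default value 0
  is taken for both functions or for neither.\<close>

lemma tangent_cong:
  assumes v: "v \<in> tangent_space A p" and V: "open V" "p \<in> V" "\<And>q. q \<in> V \<Longrightarrow> u q = u' q"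
  shows "v u = v u'"
proof -
  obtain U \<phi> w where c: "(U, \<phi>) \<in> A" "p \<in> U" "v = chart_vec A (U, \<phi>) p w" using v by (rule tangentE)
  have "frechet_derivative (\<lambda>x. u (inv_into U \<phi> x)) (at (\<phi> p)) = frechet_derivative (\<lambda>x. u' (inv_into U \<phi> x)) (at (\<phi> p))"
    by (rule frechet_derivative_cong[OF chart_open_image[OF c(1) V(1)]])
       (use V c in \<open>auto simp: chart_inv\<close>)
  then show ?thesis
    using smooth_near_cong[OF V] unfolding c(3) chart_vec_def by simp
qed

lemma tangent_add:
  assumes "v \<in> tangent_space A p" "smooth_near A p u" "smooth_near A p u'"
  shows "v (\<lambda>q. u q + u' q) = v u + v u'"
  using assms(1)
proof (rule tangentE)
  fix U \<phi> w assume c: "(U, \<phi>) \<in> A" "p \<in> U" and v: "v = chart_vec A (U, \<phi>) p w"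
  show ?thesis unfolding v chart_vec_smooth[OF assms(2)] chart_vec_smooth[OF assms(3)]
    by (rule chart_vec_eq[OF smooth_near_add[OF assms(2,3)]])
       (rule has_derivative_add[OF smooth_near_rep[OF assms(2) c] smooth_near_rep[OF assms(3) c]])
qed

lemma tangent_mult:
  assumes "v \<in> tangent_space A p" "smooth_near A p u" "smooth_near A p u'"
  shows "v (\<lambda>q. u q * u' q) = v u * u' p + u p * v u'"
  using assms(1)
proof (rule tangentE)
  fix U \<phi> w assume c: "(U, \<phi>) \<in> A" "p \<in> U" and v: "v = chart_vec A (U, \<phi>) p w"
  show ?thesis unfolding v chart_vec_smooth[OF assms(2)] chart_vec_smooth[OF assms(3)]
    by (subst chart_vec_eq[OF smooth_near_mult[OF assms(2,3)]
          has_derivative_mult[OF smooth_near_rep[OF assms(2) c] smooth_near_rep[OF assms(3) c]]])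
       (simp add: chart_inv[OF c])
qed

lemma tangent_const:
  assumes "v \<in> tangent_space A p" shows "v (\<lambda>q. c) = 0"
  using assms
proof (rule tangentE)
  fix U \<phi> w assume v: "v = chart_vec A (U, \<phi>) p w"
  show ?thesis unfolding v
    by (rule chart_vec_eq[OF smooth_near_const[OF tangent_points[OF assms]] has_derivative_const])
qed

lemma tangent_uminus:
  assumes "v \<in> tangent_space A p" "smooth_near A p u"
  shows "v (\<lambda>q. - u q) = - v u"
  using tangent_mult[OF assms(1) smooth_near_const[OF tangent_points[OF assms(1)], of "-1"] assms(2)]
    tangent_const[OF assms(1)] by simp

lemma tangent_diff:
  assumes "v \<in> tangent_space A p" "smooth_near A p u" "smooth_near A p u'"
  shows "v (\<lambda>q. u q - u' q) = v u - v u'"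
proof -
  have "smooth_near A p (\<lambda>q. - u' q)"
    using smooth_near_mult[OF smooth_near_const[OF tangent_points[OF assms(1)], of "-1"] assms(3)] by simp
  from tangent_add[OF assms(1,2) this] show ?thesis
    using tangent_uminus[OF assms(1,3)] by simp
qed

text \<open>\<open>tangent_space\<close> collects vectors from all charts around p. The Jacobian of
  a transition map converts their coefficients, so one chart suffices, and closure under linear
  combinations follows.\<close>

lemma tangent_space_chart:
  assumes c: "(U, \<phi>) \<in> A" "p \<in> U"
  shows "tangent_space A p = range (chart_vec A (U, \<phi>) p)"
proof (intro equalityI subsetI)
  fix v assume "v \<in> tangent_space A p"
  then obtain V \<psi> w' where c': "(V, \<psi>) \<in> A" "p \<in> V" and v: "v = chart_vec A (V, \<psi>) p w'" by (rule tangentE)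
  let ?T = "\<lambda>x. \<phi> (inv_into V \<psi> x)"
  have open': "open (\<psi> ` (V \<inter> U))" by (rule chart_open_image[OF c'(1) chart_open[OF c(1)]])
  have dT: "(?T has_derivative (\<lambda>h. \<chi> j. frechet_derivative (\<lambda>x. ?T x $ j) (at (\<psi> p)) h)) (at (\<psi> p))"
    using c c' by (intro differentiable_vec Cinf_on_differentiable[OF chart_transition[OF c(1) c'(1)]]) auto
  have "chart_vec A (V, \<psi>) p w' u = chart_vec A (U, \<phi>) p (\<chi> j. frechet_derivative (\<lambda>x. ?T x $ j) (at (\<psi> p)) w') u"
    if u: "smooth_near A p u" for u
  proof (rule chart_vec_eq[OF u])
    have "((\<lambda>x. u (inv_into U \<phi> (?T x))) has_derivative
        (\<lambda>h. frechet_derivative (\<lambda>x. u (inv_into U \<phi> x)) (at (\<phi> p)) (\<chi> j. frechet_derivative (\<lambda>x. ?T x $ j) (at (\<psi> p)) h))) (at (\<psi> p))"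
      using has_derivative_compose[OF dT, of "\<lambda>x. u (inv_into U \<phi> x)"] smooth_near_rep[OF u c]
      by (simp add: chart_inv[OF c'])
    then show "((\<lambda>x. u (inv_into V \<psi> x)) has_derivative
        (\<lambda>h. chart_vec A (U, \<phi>) p (\<chi> j. frechet_derivative (\<lambda>x. ?T x $ j) (at (\<psi> p)) h) u)) (at (\<psi> p))"
      unfolding chart_vec_smooth[OF u]
      by (rule has_derivative_transform_within_open[OF _ open'])
         (use c c' in \<open>auto simp: chart_inv\<close>)
  qed
  then have "v = chart_vec A (U, \<phi>) p (\<chi> j. frechet_derivative (\<lambda>x. ?T x $ j) (at (\<psi> p)) w')"
    unfolding v by (auto simp: fun_eq_iff chart_vec_def)
  then show "v \<in> range (chart_vec A (U, \<phi>) p)" by blast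
qed (use chart_vec_in[OF c] in auto)

lemma chart_vec_linear:
  assumes "(U, \<phi>) \<in> A" "p \<in> U"
  shows "linear (\<lambda>w. chart_vec A (U, \<phi>) p w u)"
proof (cases "smooth_near A p u")
  case True
  then show ?thesis
    using has_derivative_linear[OF smooth_near_rep[OF True assms]] by (simp add: chart_vec_smooth)
next
  case False
  then show ?thesis by (simp add: chart_vec_def linear_iff)
qed

lemma tangent_lincomb:
  assumes "v \<in> tangent_space A p" "w \<in> tangent_space A p"
  shows "(\<lambda>u. a * v u + b * w u) \<in> tangent_space A p"
proof -
  obtain U \<phi> where c: "(U, \<phi>) \<in> A" "p \<in> U" using assms(1) by (rule tangentE)
  obtain x y where "v = chart_vec A (U, \<phi>) p x" "w = chart_vec A (U, \<phi>) p y"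
    using assms by (auto simp: tangent_space_chart[OF c])
  then have "(\<lambda>u. a * v u + b * w u) = chart_vec A (U, \<phi>) p (a *\<^sub>R x + b *\<^sub>R y)"
    by (simp add: fun_eq_iff linear_add[OF chart_vec_linear[OF c]] linear_cmul[OF chart_vec_linear[OF c]])
  then show ?thesis using chart_vec_in[OF c] by simp
qed

lemma tangent_scale: "v \<in> tangent_space A p \<Longrightarrow> (\<lambda>u. a * v u) \<in> tangent_space A p"
  using tangent_lincomb[of v p v a 0] by simp

lemma tangent_zero: "p \<in> points A \<Longrightarrow> (\<lambda>u. 0) \<in> tangent_space A p"
  using tangent_scale[of _ p 0] chart_vec_in points_chart by (metis (no_types, lifting) ext mult_zero_left)

lemma tangent_sum:
  assumes "p \<in> points A" "\<And>i. i \<in> S \<Longrightarrow> X i \<in> tangent_space A p"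
  shows "(\<lambda>u. \<Sum>i\<in>S. h i * X i u) \<in> tangent_space A p"
  using assms(2)
proof (induction S rule: infinite_finite_induct)
  case (insert x F)
  then show ?case
    using tangent_lincomb[of "X x" p "\<lambda>u. \<Sum>i\<in>F. h i * X i u" "h x" 1] by simp
qed (simp_all add: tangent_zero assms(1))

lemma chart_vec_coord:
  assumes "(U, \<phi>) \<in> A" "p \<in> U"
  shows "chart_vec A (U, \<phi>) p w (\<lambda>q. \<phi> q $ i) = w $ i"
proof (rule chart_vec_eq[OF smooth_nearI[OF smooth_fun_on_coord[OF assms(1)] assms(2)]])
  have "((\<lambda>x. x $ i) has_derivative (\<lambda>w. w $ i)) (at (\<phi> p))"
    by (rule bounded_linear_imp_has_derivative[OF bounded_linear_vec_nth])
  then show "((\<lambda>x. \<phi> (inv_into U \<phi> x) $ i) has_derivative (\<lambda>w. w $ i)) (at (\<phi> p))"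
    by (rule has_derivative_transform_within_open[OF _ chart_open_image[OF assms(1) open_UNIV]])
       (use assms in \<open>auto simp: chart_inv\<close>)
qed

lemma tangent_expand:
  assumes c: "(U, \<phi>) \<in> A" "p \<in> U" and v: "v \<in> tangent_space A p"
  shows "v u = (\<Sum>i\<in>UNIV. v (\<lambda>q. \<phi> q $ i) * coord_field A (U, \<phi>) i p u)"
proof -
  obtain w where w: "v = chart_vec A (U, \<phi>) p w" using v by (auto simp: tangent_space_chart[OF c])
  show ?thesis
    using linear_sum_axis[OF chart_vec_linear[OF c, of u], of w]
    by (simp add: w chart_vec_coord[OF c] coord_field_def)
qed

section \<open>Smooth vector fields and the Lie bracket\<close>

lemma smooth_vfield_onD:
  "smooth_vfield_on A W X \<Longrightarrow> open W" "smooth_vfield_on A W X \<Longrightarrow> W \<subseteq> points A"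
  "smooth_vfield_on A W X \<Longrightarrow> p \<in> W \<Longrightarrow> X p \<in> tangent_space A p"
  "smooth_vfield_on A W X \<Longrightarrow> V \<subseteq> W \<Longrightarrow> smooth_fun_on A V u \<Longrightarrow> smooth_fun_on A V (\<lambda>p. X p u)"
  unfolding smooth_vfield_on_def by auto

lemma smooth_near_vfield:
  assumes "smooth_vfield_on A W X" "p \<in> W" "smooth_near A p u"
  shows "smooth_near A p (\<lambda>q. X q u)"
  using smooth_near_within[OF assms(3) smooth_vfield_onD(1)[OF assms(1)] assms(2)]
  by (metis smooth_vfield_onD(4)[OF assms(1)] smooth_nearI)

lemma smooth_vfield_on_cong:
  assumes "smooth_vfield_on A W X" "\<And>p. p \<in> W \<Longrightarrow> X p = Y p"
  shows "smooth_vfield_on A W Y"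
proof -
  have "smooth_fun_on A V (\<lambda>p. Y p u)" if "V \<subseteq> W" "smooth_fun_on A V u" for V u
    by (rule smooth_fun_on_cong[OF smooth_vfield_onD(4)[OF assms(1) that]]) (use assms that in auto)
  then show ?thesis using assms unfolding smooth_vfield_on_def by simp
qed

lemma smooth_vfield_on_subset:
  "smooth_vfield_on A W X \<Longrightarrow> open V \<Longrightarrow> V \<subseteq> W \<Longrightarrow> smooth_vfield_on A V X"
  unfolding smooth_vfield_on_def by (meson subset_trans subsetD)

lemma smooth_vfield_on_add:
  assumes "smooth_vfield_on A W X" "smooth_vfield_on A W Y"
  shows "smooth_vfield_on A W (vf_add X Y)"
  using assms tangent_lincomb[of _ _ _ 1 1]
  unfolding smooth_vfield_on_def vf_add_def by (auto intro: smooth_fun_on_add)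

lemma smooth_vfield_on_scale:
  assumes "smooth_vfield_on A W X" "smooth_fun_on A W h"
  shows "smooth_vfield_on A W (vf_scale h X)"
  using assms tangent_scale smooth_fun_on_subset[OF assms(2)] smooth_fun_onD(2)
  unfolding smooth_vfield_on_def vf_scale_def by (auto intro!: smooth_fun_on_mult)

lemma smooth_vfield_on_zero:
  "open W \<Longrightarrow> W \<subseteq> points A \<Longrightarrow> smooth_vfield_on A W (\<lambda>p u. 0)"
  unfolding smooth_vfield_on_def
  by (auto intro!: tangent_zero smooth_fun_on_const dest: smooth_fun_onD)

lemma smooth_vfield_on_sum:
  assumes "open W" "W \<subseteq> points A" "\<And>i. i \<in> S \<Longrightarrow> smooth_vfield_on A W (X i)" "\<And>i. i \<in> S \<Longrightarrow> smooth_fun_on A W (h i)"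
  shows "smooth_vfield_on A W (\<lambda>p u. \<Sum>i\<in>S. h i p * X i p u)"
  using assms(3,4)
proof (induction S rule: infinite_finite_induct)
  case (insert x F)
  then have "smooth_vfield_on A W (vf_add (vf_scale (h x) (X x)) (\<lambda>p u. \<Sum>i\<in>F. h i p * X i p u))"
    by (intro smooth_vfield_on_add smooth_vfield_on_scale) auto
  then show ?case using insert by (simp add: vf_add_def vf_scale_def)
qed (simp_all add: smooth_vfield_on_zero assms(1,2))

lemma smooth_vfield_on_coord:
  assumes c: "(U, \<phi>) \<in> A" shows "smooth_vfield_on A U (coord_field A (U, \<phi>) i)"
proof -
  have "smooth_fun_on A V (\<lambda>p. coord_field A (U, \<phi>) i p u)" if V: "V \<subseteq> U" "smooth_fun_on A V u" for V u
  proof -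
    have "U \<inter> V = V" using V by auto
    then have "smooth_fun_on A V (\<lambda>p. partial_deriv i (\<lambda>x. u (inv_into U \<phi> x)) (\<phi> p))"
      using smooth_fun_onD(1)[OF V(2) c]
      by (intro smooth_fun_on_chart[OF c smooth_fun_onD(2)[OF V(2)] V(1)] Cinf_on_partial) simp
    then show ?thesis
      by (rule smooth_fun_on_cong)
         (use V in \<open>auto simp: coord_field_def chart_vec_def partial_deriv_def intro: smooth_nearI\<close>)
  qed
  then show ?thesis
    using chart_open[OF c] chart_subset_points[OF c] chart_vec_in[OF c]
    unfolding smooth_vfield_on_def by (auto simp: coord_field_def)
qed

text \<open>Expanded on a function smooth near p, each ordering of the three derivations occurs
  twice, with opposite signs. On any other function every bracket is 0 by definition.\<close>

lemma bracket_jacobi: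
  assumes X: "smooth_vfield_on A W X" and Y: "smooth_vfield_on A W Y" and Z: "smooth_vfield_on A W Z"
    and p: "p \<in> W"
  shows "bracket A X (bracket A Y Z) p u + bracket A Y (bracket A Z X) p u + bracket A Z (bracket A X Y) p u = 0"
proof (cases "smooth_near A p u")
  case True
  have W: "open W" using X by (rule smooth_vfield_onD)
  obtain N where N: "p \<in> N" "N \<subseteq> W" "smooth_fun_on A N u"
    using smooth_near_within[OF True W p] .
  have "bracket A X (bracket A Y Z) p u = X p (\<lambda>q. Y q (\<lambda>r. Z r u)) - X p (\<lambda>q. Z q (\<lambda>r. Y r u))
      - Y p (\<lambda>q. Z q (\<lambda>r. X r u)) + Z p (\<lambda>q. Y q (\<lambda>r. X r u))"
    if X: "smooth_vfield_on A W X" and Y: "smooth_vfield_on A W Y" and Z: "smooth_vfield_on A W Z" for X Y Z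
  proof -
    have "X p (\<lambda>q. bracket A Y Z q u) = X p (\<lambda>q. Y q (\<lambda>r. Z r u) - Z q (\<lambda>r. Y r u))"
      by (rule tangent_cong[OF smooth_vfield_onD(3)[OF X p] smooth_fun_onD(2)[OF N(3)] N(1)])
         (use N in \<open>auto simp: bracket_def intro: smooth_nearI\<close>)
    also have "\<dots> = X p (\<lambda>q. Y q (\<lambda>r. Z r u)) - X p (\<lambda>q. Z q (\<lambda>r. Y r u))"
      by (rule tangent_diff[OF smooth_vfield_onD(3)[OF X p]])
         (intro smooth_near_vfield[OF Y p] smooth_near_vfield[OF Z p] True)+
    finally show ?thesis
      using True smooth_near_vfield[OF X p True] by (simp add: bracket_def)
  qed
  then show ?thesis using X Y Z by simp
qed (simp add: bracket_def)

end


section \<open>Orthonormal frames and gradients\<close>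

locale riemannian = smooth_manifold A
  for A :: "('a::{t2_space,second_countable_topology}, 'm::finite) chart set" +
  fixes g :: "'a metric"
  assumes metric: "riemannian_metric A g"
begin

lemma g_facts:
  assumes "v \<in> tangent_space A p" "w \<in> tangent_space A p"
  shows g_sym: "g p v w = g p w v"
    and g_pos: "v \<noteq> (\<lambda>u. 0) \<Longrightarrow> g p v v > 0"
    and g_lincomb: "z \<in> tangent_space A p \<Longrightarrow> g p (\<lambda>u. a * v u + b * w u) z = a * g p v z + b * g p w z"
  using metric[unfolded riemannian_metric_def, THEN conjunct1, THEN bspec, OF tangent_points[OF assms(1)],
      THEN bspec, OF assms(1), THEN bspec, OF assms(2)]
  by (simp_all only: simp_thms)

lemma g_smooth:
  "smooth_vfield_on A W X \<Longrightarrow> smooth_vfield_on A W Y \<Longrightarrow> smooth_fun_on A W (\<lambda>p. g p (X p) (Y p))"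
  using metric unfolding riemannian_metric_def by blast

lemma g_scale: "v \<in> tangent_space A p \<Longrightarrow> z \<in> tangent_space A p \<Longrightarrow> g p (\<lambda>u. a * v u) z = a * g p v z"
  using g_lincomb[of v p v z a 0] by simp

lemma g_add: "v \<in> tangent_space A p \<Longrightarrow> w \<in> tangent_space A p \<Longrightarrow> z \<in> tangent_space A p \<Longrightarrow>
    g p (\<lambda>u. v u + w u) z = g p v z + g p w z"
  using g_lincomb[of v p w z 1 1] by simp

lemma g_zero: "z \<in> tangent_space A p \<Longrightarrow> g p (\<lambda>u. 0) z = 0"
  using g_scale[of z p z 0] by simp

lemma g_sum:
  assumes "z \<in> tangent_space A p" "\<And>i. i \<in> S \<Longrightarrow> X i \<in> tangent_space A p"
  shows "g p (\<lambda>u. \<Sum>i\<in>S. h i * X i u) z = (\<Sum>i\<in>S. h i * g p (X i) z)"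
  using assms(2)
proof (induction S rule: infinite_finite_induct)
  case (insert x F)
  then show ?case
    using g_lincomb[of "X x" p "\<lambda>u. \<Sum>i\<in>F. h i * X i u" z "h x" 1] assms(1)
      tangent_sum[OF tangent_points[OF assms(1)], of F X h] by simp
qed (simp_all add: g_zero assms(1))

lemma tangent_eqI:
  assumes "v \<in> tangent_space A p" "w \<in> tangent_space A p"
    and "\<And>z. z \<in> tangent_space A p \<Longrightarrow> g p v z = g p w z"
  shows "v = w"
proof -
  \<comment> \<open>The explicit coefficients match the shape of the linearity axiom; positivity
    then forces the difference to vanish.\<close>
  let ?d = "\<lambda>u. 1 * v u + (- 1) * w u"
  have d: "?d \<in> tangent_space A p" by (rule tangent_lincomb[OF assms(1,2)])
  have "g p ?d ?d = 0" using g_lincomb[OF assms(1,2) d, of 1 "-1"] assms(3)[OF d] by simp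
  then have "?d = (\<lambda>u. 0)" using g_pos[OF d d] by fastforce
  then show ?thesis by (auto simp: fun_eq_iff)
qed

text \<open>The family has as many members as the dimension. Orthonormality recovers coefficients,
  so the linear map \<open>L\<close> from coefficients to chart vectors is injective, hence
  surjective.\<close>

lemma orthonormal_expand:
  fixes e :: "'m \<Rightarrow> 'a tangent"
  assumes e: "\<And>a. e a \<in> tangent_space A p" and on: "\<And>a b. g p (e a) (e b) = (if a = b then 1 else 0)"
    and v: "v \<in> tangent_space A p"
  shows "v = (\<lambda>u. \<Sum>a\<in>UNIV. g p v (e a) * e a u)"
proof -
  obtain U \<phi> where c: "(U, \<phi>) \<in> A" "p \<in> U" using v by (rule tangentE)
  have "\<exists>w. e a = chart_vec A (U, \<phi>) p w" for a
    using e[of a] by (auto simp: tangent_space_chart[OF c])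
  then obtain w where w: "\<And>a. e a = chart_vec A (U, \<phi>) p (w a)" by metis
  define L where "L = (\<lambda>x. \<Sum>a\<in>UNIV. x $ a *\<^sub>R w a)"
  have "linear L"
    by (simp add: L_def linear_iff sum.distrib scaleR_add_left scaleR_sum_right)
  have L: "chart_vec A (U, \<phi>) p (L x) u = (\<Sum>a\<in>UNIV. x $ a * e a u)" for x u
    unfolding L_def w linear_sum[OF chart_vec_linear[OF c]] linear_cmul[OF chart_vec_linear[OF c]] by simp
  have coeff: "g p (chart_vec A (U, \<phi>) p (L x)) (e b) = x $ b" for x b
  proof -
    have "chart_vec A (U, \<phi>) p (L x) = (\<lambda>u. \<Sum>a\<in>UNIV. x $ a * e a u)" by (simp add: L fun_eq_iff)
    then show ?thesis by (simp add: g_sum e on if_distrib cong: if_cong)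
  qed
  have "inj L"
  proof (rule injI)
    fix x y assume "L x = L y"
    then have "x $ b = y $ b" for b using coeff[of x b] coeff[of y b] by simp
    then show "x = y" by (simp add: vec_eq_iff)
  qed
  then have "surj L" using \<open>linear L\<close> linear_injective_imp_surjective by blast
  moreover obtain y where "v = chart_vec A (U, \<phi>) p y" using v by (auto simp: tangent_space_chart[OF c])
  ultimately obtain x where x: "v = chart_vec A (U, \<phi>) p (L x)" by (metis surjD)
  show ?thesis using coeff[of x] L[of x] by (simp add: x fun_eq_iff)
qed

text \<open>The last clause is the invariant that keeps the process going: the fields built so far
  have components only in the coordinate directions of \<open>S\<close>. The next coordinate field,
  minus its projection, keeps the component 1 in the new direction and therefore vanishes nowhere on
  \<open>U\<close>.\<close>

lemma gram_schmidt:
  assumes c: "(U, \<phi>) \<in> A" and "finite S"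
  shows "\<exists>E. (\<forall>i\<in>S. smooth_vfield_on A U (E i)) \<and>
    (\<forall>p\<in>U. \<forall>i\<in>S. \<forall>j\<in>S. g p (E i p) (E j p) = (if i = j then 1 else 0)) \<and>
    (\<forall>p\<in>U. \<forall>i\<in>S. \<forall>k. k \<notin> S \<longrightarrow> E i p (\<lambda>q. \<phi> q $ k) = 0)"
  using assms(2)
proof (induction S rule: finite_induct)
  case (insert x S)
  from insert.IH obtain E where IH: "\<forall>i\<in>S. smooth_vfield_on A U (E i)"
    "\<forall>p\<in>U. \<forall>i\<in>S. \<forall>j\<in>S. g p (E i p) (E j p) = (if i = j then 1 else 0)"
    "\<forall>p\<in>U. \<forall>i\<in>S. \<forall>k. k \<notin> S \<longrightarrow> E i p (\<lambda>q. \<phi> q $ k) = 0"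
    by (elim exE conjE)
  have E: "smooth_vfield_on A U (E i)" if "i \<in> S" for i
    using IH(1) that by (rule bspec)
  have on: "g p (E i p) (E j p) = (if i = j then 1 else 0)" if "p \<in> U" "i \<in> S" "j \<in> S" for p i j
    using IH(2) that by simp
  have tri: "E i p (\<lambda>q. \<phi> q $ k) = 0" if "p \<in> U" "i \<in> S" "k \<notin> S" for p i k
    using IH(3) that by simp
  let ?X = "coord_field A (U, \<phi>) x"
  have X: "smooth_vfield_on A U ?X" by (rule smooth_vfield_on_coord[OF c])
  have XT: "?X p \<in> tangent_space A p" and ET: "i \<in> S \<Longrightarrow> E i p \<in> tangent_space A p" if "p \<in> U" for p i
    using that X E by (auto intro: smooth_vfield_onD)
  \<comment> \<open>\<open>P\<close> is minus the orthogonal projection of the new coordinate field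
    onto the fields already built.\<close>
  define P where "P = (\<lambda>p u. \<Sum>i\<in>S. - g p (?X p) (E i p) * E i p u)"
  have P: "smooth_vfield_on A U P"
    unfolding P_def using X E smooth_vfield_onD(1,2)[OF X]
    by (intro smooth_vfield_on_sum smooth_fun_on_uminus g_smooth) auto
  define Y where "Y = vf_add ?X P"
  have Y: "smooth_vfield_on A U Y" unfolding Y_def by (rule smooth_vfield_on_add[OF X P])
  have YT: "Y p \<in> tangent_space A p" if "p \<in> U" for p by (rule smooth_vfield_onD(3)[OF Y that])
  have orth: "g p (Y p) (E j p) = 0" if p: "p \<in> U" and j: "j \<in> S" for p j
  proof -
    have "g p (Y p) (E j p) = g p (?X p) (E j p) + g p (P p) (E j p)"
      unfolding Y_def vf_add_def
      by (rule g_add[OF XT[OF p] smooth_vfield_onD(3)[OF P p] ET[OF p j]])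
    also have "g p (P p) (E j p) = (\<Sum>i\<in>S. - g p (?X p) (E i p) * (if i = j then 1 else 0))"
      unfolding P_def using p j on by (subst g_sum) (auto simp: ET intro!: sum.cong)
    also have "\<dots> = - g p (?X p) (E j p)"
      using j insert.hyps(1) by (simp add: if_distrib cong: if_cong)
    finally show ?thesis by simp
  qed
  have Xc: "?X p (\<lambda>q. \<phi> q $ k) = (if k = x then 1 else 0)" if "p \<in> U" for p k
    using chart_vec_coord[OF c that] by (simp add: coord_field_def axis_def)
  have Yc: "Y p (\<lambda>q. \<phi> q $ k) = (if k = x then 1 else 0)" if "p \<in> U" "k \<notin> S" for p k
    using that by (simp add: Y_def vf_add_def P_def Xc tri)
  have pos: "g p (Y p) (Y p) > 0" if "p \<in> U" for p
  proof -
    have "Y p \<noteq> (\<lambda>u. 0)" using Yc[OF that insert.hyps(2)] by auto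
    then show ?thesis by (rule g_pos[OF YT[OF that] YT[OF that]])
  qed
  \<comment> \<open>The power -1/2 of the squared length is the reciprocal length of
    \<open>Y\<close>, smooth because its base is positive.\<close>
  define n where "n = (\<lambda>p. g p (Y p) (Y p) powr (- 1 / 2))"
  have n: "smooth_fun_on A U n"
    unfolding n_def by (intro smooth_fun_on_powr g_smooth Y pos)
  have nsq: "n p * (n p * g p (Y p) (Y p)) = 1" if "p \<in> U" for p
    using pos[OF that] by (simp add: n_def flip: powr_add mult.assoc)
  have NT: "vf_scale n Y p \<in> tangent_space A p" if "p \<in> U" for p
    unfolding vf_scale_def by (rule tangent_scale[OF YT[OF that]])
  have g1: "g p (vf_scale n Y p) z = n p * g p (Y p) z" if "p \<in> U" "z \<in> tangent_space A p" for p z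
    unfolding vf_scale_def by (rule g_scale[OF YT[OF that(1)] that(2)])
  let ?E = "E(x := vf_scale n Y)"
  have x: "x \<notin> S" by fact
  have "g p (?E i p) (?E j p) = (if i = j then 1 else 0)" if p: "p \<in> U" and ij: "i \<in> insert x S" "j \<in> insert x S" for p i j
  proof -
    have gx: "g p (vf_scale n Y p) (E j p) = 0" if "j \<in> S" for j
      using g1[OF p ET[OF p that]] orth[OF p that] by simp
    moreover have "g p (E j p) (vf_scale n Y p) = 0" if "j \<in> S" for j
      using gx[OF that] g_sym[OF NT[OF p] ET[OF p that]] by simp
    moreover have "g p (vf_scale n Y p) (vf_scale n Y p) = 1"
      using g1[OF p NT[OF p]] g_sym[OF NT[OF p] YT[OF p]] g1[OF p YT[OF p]] nsq[OF p] by simp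
    ultimately show ?thesis using on[OF p] ij x by auto
  qed
  moreover have "?E i p (\<lambda>q. \<phi> q $ k) = 0" if "p \<in> U" "i \<in> insert x S" "k \<notin> insert x S" for p i k
    using that tri[of p i k] Yc[of p k] by (auto simp: vf_scale_def)
  moreover have "smooth_vfield_on A U (?E i)" if "i \<in> insert x S" for i
    using that E smooth_vfield_on_scale[OF Y n] by auto
  ultimately show ?case by blast
qed simp

lemma orthonormal_frame_exists:
  assumes "p \<in> points A"
  shows "\<exists>E W. p \<in> W \<and> orthonormal_frame_on A g W E"
proof -
  obtain U \<phi> where c: "(U, \<phi>) \<in> A" "p \<in> U" using points_chart[OF assms] .
  obtain E where "orthonormal_frame_on A g U E"
    using gram_schmidt[OF c(1), of "UNIV :: 'm set"] unfolding orthonormal_frame_on_def by auto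
  then show ?thesis using c(2) by blast
qed

lemma grad_eqI:
  assumes "v \<in> tangent_space A p" "\<And>w. w \<in> tangent_space A p \<Longrightarrow> g p v w = w u"
  shows "grad A g u p = v"
  unfolding grad_def by (rule the_equality) (use assms tangent_eqI in auto)

end


section \<open>The calculus of vector fields on the domain of a frame\<close>

lemma sum_fun_apply: "(\<Sum>a\<in>S. Z a) x = (\<Sum>a\<in>S. Z a x)" for Z :: "'i \<Rightarrow> 'b \<Rightarrow> 'c::comm_monoid_add"
  by (induction S rule: infinite_finite_induct) simp_all

locale levi_civita_manifold = riemannian A g
  for A :: "('a::{t2_space,second_countable_topology}, 'm::finite) chart set" and g :: "'a metric" +
  fixes D :: "'a connection"
  assumes levi_civita: "levi_civita A g D"
begin

section \<open>The Levi-Civita connection and its locality\<close>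

lemma connection:
  assumes "smooth_vfield_on A W X" "smooth_vfield_on A W Y"
  shows D_smooth: "smooth_vfield_on A W (D X Y)"
    and D_add1: "smooth_vfield_on A W Z \<Longrightarrow> p \<in> W \<Longrightarrow> D (vf_add X Y) Z p = vf_add (D X Z) (D Y Z) p"
    and D_add2: "smooth_vfield_on A W Z \<Longrightarrow> p \<in> W \<Longrightarrow> D X (vf_add Y Z) p = vf_add (D X Y) (D X Z) p"
    and D_scale1: "smooth_fun_on A W h \<Longrightarrow> p \<in> W \<Longrightarrow> D (vf_scale h X) Y p = vf_scale h (D X Y) p"
    and D_scale2: "smooth_fun_on A W h \<Longrightarrow> p \<in> W \<Longrightarrow>
      D X (vf_scale h Y) p = vf_add (vf_scale (\<lambda>q. X q h) Y) (vf_scale h (D X Y)) p"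
proof -
  have *: "smooth_vfield_on A W (D X Y) \<and>
      (\<forall>p\<in>W. D (vf_add X Y) Z p = vf_add (D X Z) (D Y Z) p \<and> D (vf_scale h X) Z p = vf_scale h (D X Z) p \<and>
        D X (vf_add Y Z) p = vf_add (D X Y) (D X Z) p \<and>
        D X (vf_scale h Y) p = vf_add (vf_scale (\<lambda>q. X q h) Y) (vf_scale h (D X Y)) p)"
    if "smooth_vfield_on A W X" "smooth_vfield_on A W Y" "smooth_vfield_on A W Z" "smooth_fun_on A W h" for X Y Z h
    using that levi_civita unfolding levi_civita_def affine_connection_def by blast
  \<comment> \<open>The axiom quantifies over three fields and a function at once; the zero function
    and repeated fields fill the free places.\<close>
  have zero: "smooth_fun_on A W (\<lambda>q. 0)"
    using assms(1) by (intro smooth_fun_on_const) (auto dest: smooth_vfield_onD)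
  show "smooth_vfield_on A W (D X Y)" using *[OF assms assms(2) zero] by (rule conjunct1)
  show "D (vf_add X Y) Z p = vf_add (D X Z) (D Y Z) p" if "smooth_vfield_on A W Z" "p \<in> W"
    using *[OF assms that(1) zero] that by simp
  show "D X (vf_add Y Z) p = vf_add (D X Y) (D X Z) p" if "smooth_vfield_on A W Z" "p \<in> W"
    using *[OF assms that(1) zero] that by simp
  show "D (vf_scale h X) Y p = vf_scale h (D X Y) p" if "smooth_fun_on A W h" "p \<in> W"
    using *[OF assms(1,2,2) that(1)] that by simp
  show "D X (vf_scale h Y) p = vf_add (vf_scale (\<lambda>q. X q h) Y) (vf_scale h (D X Y)) p" if "smooth_fun_on A W h" "p \<in> W"
    using *[OF assms(1,2,2) that(1)] that by simp
qed

lemma torsion_free: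
  "smooth_vfield_on A W X \<Longrightarrow> smooth_vfield_on A W Y \<Longrightarrow> p \<in> W \<Longrightarrow> D X Y p u - D Y X p u = bracket A X Y p u"
  using levi_civita unfolding levi_civita_def torsion_free_def by blast

lemma metric_compat:
  "smooth_vfield_on A W X \<Longrightarrow> smooth_vfield_on A W Y \<Longrightarrow> smooth_vfield_on A W Z \<Longrightarrow> p \<in> W \<Longrightarrow>
    X p (\<lambda>q. g q (Y q) (Z q)) = g p (D X Y p) (Z p) + g p (Y p) (D X Z p)"
  using levi_civita unfolding levi_civita_def metric_compatible_def by blast

text \<open>
  The difference of two fields that agree on \<open>W\<close> is its own multiple by the indicator function of
  the complement of \<open>W\<close>, which is smooth on \<open>W\<close>.
\<close>

lemma D_local:
  assumes X: "smooth_vfield_on A W X" and X': "smooth_vfield_on A W X'"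
    and Y: "smooth_vfield_on A W Y" and Y': "smooth_vfield_on A W Y'"
    and eq: "\<And>q. q \<in> W \<Longrightarrow> X q = X' q" "\<And>q. q \<in> W \<Longrightarrow> Y q = Y' q" and p: "p \<in> W"
  shows "D X Y p = D X' Y' p"
proof -
  have W: "open W" "W \<subseteq> points A" using X by (auto dest: smooth_vfield_onD)
  define h where "h = (\<lambda>q. if q \<in> W then 0 else 1 :: real)"
  have h: "smooth_fun_on A W h"
    by (rule smooth_fun_on_cong[OF smooth_fun_on_const[OF W, of 0]]) (simp add: h_def)
  have m: "smooth_fun_on A W (\<lambda>q. - 1)" by (rule smooth_fun_on_const[OF W])
  define Z where "Z = (\<lambda>X X'. vf_add X (vf_scale (\<lambda>q. - 1) X') :: 'a vfield)"
  have Z: "smooth_vfield_on A W (Z X X')" if "smooth_vfield_on A W X" "smooth_vfield_on A W X'" for X X'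
    unfolding Z_def by (intro smooth_vfield_on_add smooth_vfield_on_scale that m)
  have hZ: "vf_scale h (Z X X') = Z X X'" "vf_add X' (Z X X') = X" if "\<And>q. q \<in> W \<Longrightarrow> X q = X' q" for X X'
    using that by (auto simp: Z_def h_def vf_scale_def vf_add_def fun_eq_iff)
  have "D X Y p = vf_add (D X' Y) (D (Z X X') Y) p"
    using D_add1[OF X' Z[OF X X'] Y p] hZ(2)[OF eq(1)] by simp
  also have "D (Z X X') Y p = vf_scale h (D (Z X X') Y) p"
    using D_scale1[OF Z[OF X X'] Y h p] hZ(1)[OF eq(1)] by simp
  then have "vf_add (D X' Y) (D (Z X X') Y) p = D X' Y p"
    using p by (simp add: vf_scale_def vf_add_def h_def)
  also have "D X' Y p = vf_add (D X' Y') (D X' (Z Y Y')) p"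
    using D_add2[OF X' Y' Z[OF Y Y'] p] hZ(2)[OF eq(2)] by simp
  also have "D X' (Z Y Y') p = vf_add (vf_scale (\<lambda>q. X' q h) (Z Y Y')) (vf_scale h (D X' (Z Y Y'))) p"
    using D_scale2[OF X' Z[OF Y Y'] h p] hZ(1)[OF eq(2)] by simp
  \<comment> \<open>At p both \<open>Z Y Y'\<close> and \<open>h\<close> vanish, so neither summand
    of the Leibniz rule contributes.\<close>
  then have "vf_add (D X' Y') (D X' (Z Y Y')) p = D X' Y' p"
    using p eq(2)[OF p] by (simp add: vf_scale_def vf_add_def h_def Z_def)
  finally show ?thesis .
qed

text \<open>By torsion-freeness the bracket is a difference of covariant derivatives, which are
  smooth by the axioms of a connection.\<close>

lemma bracket_smooth:
  assumes "smooth_vfield_on A W X" "smooth_vfield_on A W Y"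
  shows "smooth_vfield_on A W (bracket A X Y)"
proof (rule smooth_vfield_on_cong)
  have "smooth_fun_on A W (\<lambda>q. - 1)"
    using assms(1) by (intro smooth_fun_on_const) (auto dest: smooth_vfield_onD)
  then show "smooth_vfield_on A W (vf_add (D X Y) (vf_scale (\<lambda>q. - 1) (D Y X)))"
    using assms by (intro smooth_vfield_on_add smooth_vfield_on_scale D_smooth)
  fix p assume "p \<in> W"
  then show "vf_add (D X Y) (vf_scale (\<lambda>q. - 1) (D Y X)) p = bracket A X Y p"
    using torsion_free[OF assms] by (auto simp: vf_add_def vf_scale_def fun_eq_iff)
qed

end

locale levi_civita_frame = levi_civita_manifold A g D
  for A :: "('a::{t2_space,second_countable_topology}, 'm::finite) chart set"
    and g :: "'a metric" and D :: "'a connection" +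
  fixes W :: "'a set" and E :: "'m \<Rightarrow> 'a vfield"
  assumes orthonormal: "orthonormal_frame_on A g W E"
begin

lemma E_smooth: "smooth_vfield_on A W (E a)"
  using orthonormal by (simp add: orthonormal_frame_on_def)

lemma W_open: "open W" and W_points: "W \<subseteq> points A"
  using smooth_vfield_onD[OF E_smooth] by auto

text \<open>
  Functions and fields on \<open>W\<close> are represented by their extensions by zero, so that equality on \<open>W\<close>
  becomes equality and the algebraic identities of \<open>riemann_alg\<close> apply.
\<close>

definition resf :: "('a \<Rightarrow> real) \<Rightarrow> 'a \<Rightarrow> real" where "resf h = (\<lambda>p. if p \<in> W then h p else 0)"

definition resv :: "'a vfield \<Rightarrow> 'a vfield" where "resv X = (\<lambda>p. if p \<in> W then X p else (\<lambda>u. 0))"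

definition Fs :: "('a \<Rightarrow> real) set" where "Fs = {h. smooth_fun_on A W h \<and> (\<forall>p. p \<notin> W \<longrightarrow> h p = 0)}"

definition Vs :: "'a vfield set" where "Vs = {X. smooth_vfield_on A W X \<and> (\<forall>p. p \<notin> W \<longrightarrow> X p = (\<lambda>u. 0))}"

lemma resf_in [simp]: "p \<in> W \<Longrightarrow> resf h p = h p" and resf_out [simp]: "p \<notin> W \<Longrightarrow> resf h p = 0"
  by (simp_all add: resf_def)

lemma resv_in [simp]: "p \<in> W \<Longrightarrow> resv X p = X p" and resv_out [simp]: "p \<notin> W \<Longrightarrow> resv X p = (\<lambda>u. 0)"
  by (simp_all add: resv_def)

lemma resf_Fs: "smooth_fun_on A W h \<Longrightarrow> resf h \<in> Fs"
  by (auto simp: Fs_def intro: smooth_fun_on_cong)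

lemma resv_Vs: "smooth_vfield_on A W X \<Longrightarrow> resv X \<in> Vs"
  by (auto simp: Vs_def intro: smooth_vfield_on_cong)

lemma FsD: "h \<in> Fs \<Longrightarrow> smooth_fun_on A W h" "h \<in> Fs \<Longrightarrow> p \<notin> W \<Longrightarrow> h p = 0"
  by (auto simp: Fs_def)

lemma VsD: "X \<in> Vs \<Longrightarrow> smooth_vfield_on A W X" "X \<in> Vs \<Longrightarrow> p \<notin> W \<Longrightarrow> X p = (\<lambda>u. 0)"
  "X \<in> Vs \<Longrightarrow> p \<in> W \<Longrightarrow> X p \<in> tangent_space A p"
  by (auto simp: Vs_def dest: smooth_vfield_onD)

lemma FsI: "smooth_fun_on A W h \<Longrightarrow> (\<And>p. p \<notin> W \<Longrightarrow> h p = 0) \<Longrightarrow> h \<in> Fs"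
  by (simp add: Fs_def)

lemma VsI: "smooth_vfield_on A W X \<Longrightarrow> (\<And>p u. p \<notin> W \<Longrightarrow> X p u = 0) \<Longrightarrow> X \<in> Vs"
  by (simp add: Vs_def fun_eq_iff)

lemma Fs_near: "h \<in> Fs \<Longrightarrow> p \<in> W \<Longrightarrow> smooth_near A p h"
  by (metis FsD(1) smooth_nearI)

lemma resv_eqI:
  assumes "\<And>p u. p \<in> W \<Longrightarrow> X p u = Y p u" "\<And>p u. p \<notin> W \<Longrightarrow> Y p u = 0" shows "resv X = Y"
  using assms by (auto simp: fun_eq_iff resv_def)

lemma D_res:
  assumes "smooth_vfield_on A W X" "smooth_vfield_on A W Y" "p \<in> W"
  shows "D (resv X) (resv Y) p = D X Y p"
  using assms by (intro D_local[of W]) (auto intro: VsD resv_Vs)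

lemma vf_plus: "X + Y = vf_add X Y" for X Y :: "'a vfield"
  by (simp add: plus_fun_def vf_add_def)

text \<open>\<open>resf\<close> and \<open>resv\<close> wrap the metric, the connection and the
  frame, whose values off \<open>W\<close> are arbitrary. Derivatives along members of
  \<open>Vs\<close>, and their multiples, vanish there already.\<close>

sublocale alg: riemann_alg Fs Vs vf_scale "\<lambda>X h p. X p h" "\<lambda>X Y. resf (\<lambda>p. g p (X p) (Y p))"
  "\<lambda>X Y. resv (D X Y)" "\<lambda>a. resv (E a)"
proof
  show "(0 :: 'a \<Rightarrow> real) \<in> Fs"
    by (auto simp: zero_fun_def intro!: FsI smooth_fun_on_const W_open W_points)
  show "h + k \<in> Fs" "h * k \<in> Fs" if "h \<in> Fs" "k \<in> Fs" for h k
    using that unfolding plus_fun_def times_fun_def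
    by (intro FsI smooth_fun_on_add smooth_fun_on_mult; simp add: FsD)+
  show "- h \<in> Fs" if "h \<in> Fs" for h
    using that unfolding fun_Compl_def by (intro FsI smooth_fun_on_uminus; simp add: FsD)
  show "(0 :: 'a vfield) \<in> Vs"
    by (auto simp: zero_fun_def intro!: VsI smooth_vfield_on_zero W_open W_points)
  show "X + Y \<in> Vs" if "X \<in> Vs" "Y \<in> Vs" for X Y
    using that unfolding vf_plus by (intro VsI smooth_vfield_on_add) (simp_all add: vf_add_def VsD)
  show scale: "vf_scale h X \<in> Vs" if "h \<in> Fs" "X \<in> Vs" for h X
    using that by (intro VsI smooth_vfield_on_scale) (simp_all add: vf_scale_def VsD FsD)
  have neg: "- X = vf_scale (resf (\<lambda>q. - 1)) X" if "X \<in> Vs" for X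
  proof (intro ext)
    fix p u
    show "(- X) p u = vf_scale (resf (\<lambda>q. - 1)) X p u"
      using that by (cases "p \<in> W") (simp_all add: vf_scale_def VsD)
  qed
  show "- X \<in> Vs" if "X \<in> Vs" for X
    unfolding neg[OF that] by (intro scale that resf_Fs smooth_fun_on_const W_open W_points)
  show "resv (D X Y) \<in> Vs" if "X \<in> Vs" "Y \<in> Vs" for X Y
    using that by (intro resv_Vs D_smooth VsD)
  show "resv (E a) \<in> Vs" for a by (rule resv_Vs[OF E_smooth])
  show "(\<lambda>p. X p h) \<in> Fs" if "X \<in> Vs" "h \<in> Fs" for X h
    using that by (intro FsI smooth_vfield_onD(4)[of W X W h]) (simp_all add: VsD FsD)
  show "resf (\<lambda>p. g p (X p) (Y p)) \<in> Fs" if "X \<in> Vs" "Y \<in> Vs" for X Y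
    using that by (intro resf_Fs g_smooth VsD)
  show "vf_scale h (X + Y) = vf_scale h X + vf_scale h Y" "vf_scale (h + k) X = vf_scale h X + vf_scale k X" for h k X Y
    by (simp_all add: vf_scale_def plus_fun_def fun_eq_iff algebra_simps)
  show "(\<lambda>p. (X + Y) p h) = (\<lambda>p. X p h) + (\<lambda>p. Y p h)" for X Y :: "'a vfield" and h
    by (simp add: plus_fun_def)
  show "(\<lambda>p. X p (h + k)) = (\<lambda>p. X p h) + (\<lambda>p. X p k)" if "X \<in> Vs" "h \<in> Fs" "k \<in> Fs" for X h k
  proof
    fix p show "X p (h + k) = ((\<lambda>p. X p h) + (\<lambda>p. X p k)) p"
      using tangent_add[of "X p" p h k] that
      by (cases "p \<in> W") (auto simp: plus_fun_def VsD Fs_near)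
  qed
  show "(\<lambda>p. X p (h * k)) = (\<lambda>p. X p h) * k + h * (\<lambda>p. X p k)" if "X \<in> Vs" "h \<in> Fs" "k \<in> Fs" for X h k
  proof
    fix p show "X p (h * k) = ((\<lambda>p. X p h) * k + h * (\<lambda>p. X p k)) p"
      using tangent_mult[of "X p" p h k] that
      by (cases "p \<in> W") (auto simp: plus_fun_def times_fun_def VsD Fs_near)
  qed
  show "resf (\<lambda>p. g p (X p) (Y p)) = resf (\<lambda>p. g p (Y p) (X p))" if "X \<in> Vs" "Y \<in> Vs" for X Y
    using that by (auto simp: resf_def fun_eq_iff VsD intro: g_sym)
  show "resf (\<lambda>p. g p ((X + Y) p) (Z p)) = resf (\<lambda>p. g p (X p) (Z p)) + resf (\<lambda>p. g p (Y p) (Z p))"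
    if "X \<in> Vs" "Y \<in> Vs" "Z \<in> Vs" for X Y Z
    using that g_add[of "X p" p "Y p" "Z p" for p] by (auto simp: resf_def fun_eq_iff VsD vf_plus vf_add_def)
  show "resf (\<lambda>p. g p (vf_scale h X p) (Y p)) = h * resf (\<lambda>p. g p (X p) (Y p))"
    if "X \<in> Vs" "Y \<in> Vs" "h \<in> Fs" for X Y h
    using that g_scale[of "X p" p "Y p" "h p" for p] by (auto simp: resf_def fun_eq_iff VsD vf_scale_def)
  show "resv (D (X + Y) Z) = resv (D X Z) + resv (D Y Z)" "resv (D Z (X + Y)) = resv (D Z X) + resv (D Z Y)"
    if "X \<in> Vs" "Y \<in> Vs" "Z \<in> Vs" for X Y Z
    unfolding vf_plus using that D_add1[of W X Y Z] D_add2[of W Z X Y]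
    by (auto intro!: resv_eqI simp: VsD vf_add_def)
  show "resv (D (vf_scale h X) Y) = vf_scale h (resv (D X Y))"
    "resv (D X (vf_scale h Y)) = vf_scale (\<lambda>p. X p h) Y + vf_scale h (resv (D X Y))"
    if "X \<in> Vs" "Y \<in> Vs" "h \<in> Fs" for X Y h
    unfolding vf_plus using that D_scale1[of W X Y h] D_scale2[of W X Y h]
    by (auto intro!: resv_eqI simp: VsD FsD vf_add_def vf_scale_def)
  show "(\<lambda>p. (resv (D X Y) - resv (D Y X)) p h) = (\<lambda>p. X p (\<lambda>q. Y q h)) - (\<lambda>p. Y p (\<lambda>q. X q h))"
    if "X \<in> Vs" "Y \<in> Vs" "h \<in> Fs" for X Y h
  proof
    fix p show "(resv (D X Y) - resv (D Y X)) p h = ((\<lambda>p. X p (\<lambda>q. Y q h)) - (\<lambda>p. Y p (\<lambda>q. X q h))) p"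
      using torsion_free[of W X Y p h] that by (cases "p \<in> W") (auto simp: VsD Fs_near bracket_def)
  qed
  show "(resv (D X (resv (D Y Z) - resv (D Z Y))) - resv (D (resv (D Y Z) - resv (D Z Y)) X)) +
      (resv (D Y (resv (D Z X) - resv (D X Z))) - resv (D (resv (D Z X) - resv (D X Z)) Y)) +
      (resv (D Z (resv (D X Y) - resv (D Y X))) - resv (D (resv (D X Y) - resv (D Y X)) Z)) = 0"
    if "X \<in> Vs" "Y \<in> Vs" "Z \<in> Vs" for X Y Z
  proof (intro ext)
    have br: "resv (D Y Z) - resv (D Z Y) = resv (bracket A Y Z)" if "Y \<in> Vs" "Z \<in> Vs" for Y Z
    proof (intro ext)
      fix p u show "(resv (D Y Z) - resv (D Z Y)) p u = resv (bracket A Y Z) p u"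
        using that torsion_free[of W Y Z p u] by (cases "p \<in> W") (auto simp: VsD)
    qed
    have br2: "resv (D X (resv (bracket A Y Z))) p u - resv (D (resv (bracket A Y Z)) X) p u = bracket A X (bracket A Y Z) p u"
      if V: "X \<in> Vs" "Y \<in> Vs" "Z \<in> Vs" and p: "p \<in> W" for X Y Z p u
    proof -
      have b: "smooth_vfield_on A W (bracket A Y Z)" using V by (intro bracket_smooth VsD)
      have "D X (resv (bracket A Y Z)) p = D X (bracket A Y Z) p" "D (resv (bracket A Y Z)) X p = D (bracket A Y Z) X p"
        using V p b by (auto intro!: D_local[of W] intro: VsD(1) resv_Vs)
      then show ?thesis using torsion_free[OF VsD(1)[OF V(1)] b p] p by simp
    qed
    fix p u
    show "((resv (D X (resv (D Y Z) - resv (D Z Y))) - resv (D (resv (D Y Z) - resv (D Z Y)) X)) +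
      (resv (D Y (resv (D Z X) - resv (D X Z))) - resv (D (resv (D Z X) - resv (D X Z)) Y)) +
      (resv (D Z (resv (D X Y) - resv (D Y X))) - resv (D (resv (D X Y) - resv (D Y X)) Z))) p u
      = (0 :: 'a vfield) p u"
    proof (cases "p \<in> W")
      case True
      show ?thesis
        using bracket_jacobi[of W X Y Z p u] that True br2[OF that(1,2,3) True, of u]
          br2[OF that(2,3,1) True, of u] br2[OF that(3,1,2) True, of u]
        by (simp add: br[OF that(1,2)] br[OF that(2,3)] br[OF that(3,1)] VsD plus_fun_def zero_fun_def)
    qed (simp add: plus_fun_def zero_fun_def)
  qed
  show "(\<lambda>p. X p (resf (\<lambda>p. g p (Y p) (Z p)))) =
      resf (\<lambda>p. g p (resv (D X Y) p) (Z p)) + resf (\<lambda>p. g p (Y p) (resv (D X Z) p))"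
    if "X \<in> Vs" "Y \<in> Vs" "Z \<in> Vs" for X Y Z
  proof
    fix p show "X p (resf (\<lambda>p. g p (Y p) (Z p))) =
      (resf (\<lambda>p. g p (resv (D X Y) p) (Z p)) + resf (\<lambda>p. g p (Y p) (resv (D X Z) p))) p"
    proof (cases "p \<in> W")
      case True
      have "X p (resf (\<lambda>p. g p (Y p) (Z p))) = X p (\<lambda>p. g p (Y p) (Z p))"
        by (rule tangent_cong[OF VsD(3)[OF that(1) True] W_open True]) simp
      then show ?thesis
        using True metric_compat[of W X Y Z p] that by (simp add: VsD)
    qed (use that in \<open>simp add: VsD\<close>)
  qed
  show "X = (\<Sum>a\<in>UNIV. vf_scale (resf (\<lambda>p. g p (X p) (resv (E a) p))) (resv (E a)))" if "X \<in> Vs" for X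
  proof (intro ext)
    fix p u
    show "X p u = (\<Sum>a\<in>UNIV. vf_scale (resf (\<lambda>p. g p (X p) (resv (E a) p))) (resv (E a))) p u"
    proof (cases "p \<in> W")
      case True
      have "X p = (\<lambda>u. \<Sum>a\<in>UNIV. g p (X p) (E a p) * E a p u)"
        using True orthonormal VsD(3)[OF that True]
        by (intro orthonormal_expand) (auto simp: orthonormal_frame_on_def dest: smooth_vfield_onD)
      then show ?thesis using True by (simp add: sum_fun_apply vf_scale_def fun_eq_iff)
    qed (use that in \<open>simp add: VsD sum_fun_apply vf_scale_def\<close>)
  qed
  show "(\<lambda>p. X p (resf (\<lambda>p. g p (resv (E a) p) (resv (E b) p)))) = 0" if "X \<in> Vs" for X a b
  proof
    fix p show "X p (resf (\<lambda>p. g p (resv (E a) p) (resv (E b) p))) = (0 :: 'a \<Rightarrow> real) p"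
    proof (cases "p \<in> W")
      case True
      have "X p (resf (\<lambda>p. g p (resv (E a) p) (resv (E b) p))) = X p (\<lambda>p. if a = b then 1 else 0)"
        by (rule tangent_cong[OF VsD(3)[OF that True] W_open True])
           (use orthonormal in \<open>auto simp: orthonormal_frame_on_def\<close>)
      then show ?thesis using tangent_const[OF VsD(3)[OF that True]] by simp
    qed (use that in \<open>simp add: VsD\<close>)
  qed
qed

section \<open>Gradients and traces in the frame\<close>

lemma E_tangent: "p \<in> W \<Longrightarrow> E a p \<in> tangent_space A p"
  by (rule smooth_vfield_onD(3)[OF E_smooth])

lemma E_expand: "p \<in> W \<Longrightarrow> w \<in> tangent_space A p \<Longrightarrow> w = (\<lambda>u. \<Sum>a\<in>UNIV. g p w (E a p) * E a p u)"
  using orthonormal by (intro orthonormal_expand E_tangent) (auto simp: orthonormal_frame_on_def)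

text \<open>This provides the witness for the definite description in \<open>grad\<close>, in a form
  that makes its smooth dependence on the point visible.\<close>

lemma grad_frame:
  assumes p: "p \<in> W" shows "grad A g u p = (\<lambda>u'. \<Sum>a\<in>UNIV. E a p u * E a p u')"
proof (rule grad_eqI)
  show "(\<lambda>u'. \<Sum>a\<in>UNIV. E a p u * E a p u') \<in> tangent_space A p"
    by (rule tangent_sum) (use p W_points E_tangent in auto)
  fix w assume w: "w \<in> tangent_space A p"
  have "g p (\<lambda>u'. \<Sum>a\<in>UNIV. E a p u * E a p u') w = (\<Sum>a\<in>UNIV. E a p u * g p (E a p) w)"
    by (rule g_sum[OF w]) (rule E_tangent[OF p])
  also have "\<dots> = (\<Sum>a\<in>UNIV. g p w (E a p) * E a p u)"
    using g_sym[OF E_tangent[OF p] w] by (simp add: mult.commute)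
  also have "\<dots> = w u" using fun_cong[OF E_expand[OF p w], of u] by simp
  finally show "g p (\<lambda>u'. \<Sum>a\<in>UNIV. E a p u * E a p u') w = w u" .
qed

lemma grad_inner:
  assumes "p \<in> W" and w: "w \<in> tangent_space A p" shows "g p (grad A g u p) w = w u"
proof -
  have "g p (grad A g u p) w = (\<Sum>a\<in>UNIV. E a p u * g p (E a p) w)"
    unfolding grad_frame[OF assms(1)] by (rule g_sum[OF w]) (rule E_tangent[OF assms(1)])
  also have "\<dots> = (\<Sum>a\<in>UNIV. g p w (E a p) * E a p u)"
    using g_sym[OF E_tangent[OF assms(1)] w] by (simp add: mult.commute)
  also have "\<dots> = w u" using fun_cong[OF E_expand[OF assms], of u] by simp
  finally show ?thesis .
qed

lemma grad_smooth:
  assumes "smooth_fun_on A W u" shows "smooth_vfield_on A W (grad A g u)"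
proof (rule smooth_vfield_on_cong)
  show "smooth_vfield_on A W (\<lambda>p u'. \<Sum>a\<in>UNIV. E a p u * E a p u')"
    using assms by (intro smooth_vfield_on_sum W_open W_points E_smooth smooth_vfield_onD(4)[OF E_smooth]) auto
qed (simp add: grad_frame)

text \<open>\<open>D_local\<close> removes the extensions by zero, and torsion-freeness turns the
  difference inside \<open>alg.br\<close> into \<open>bracket\<close>.\<close>

lemma curvature_res:
  assumes X: "smooth_vfield_on A W X" and Y: "smooth_vfield_on A W Y" and Z: "smooth_vfield_on A W Z"
    and p: "p \<in> W"
  shows "alg.R (resv X) (resv Y) (resv Z) p = curvature A D X Y Z p"
proof -
  have 1: "D (resv X) (resv (D (resv Y) (resv Z))) p = D X (D Y Z) p"
    if "smooth_vfield_on A W X" "smooth_vfield_on A W Y" "smooth_vfield_on A W Z" for X Y Z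
    using that p by (intro D_local[of W]) (auto simp: D_res intro!: VsD(1)[OF resv_Vs] D_smooth)
  have 2: "D (resv (D (resv X) (resv Y)) - resv (D (resv Y) (resv X))) (resv Z) p = D (bracket A X Y) Z p"
  proof (rule D_local[OF _ bracket_smooth[OF X Y] _ Z _ _ p])
    show "smooth_vfield_on A W (resv (D (resv X) (resv Y)) - resv (D (resv Y) (resv X)))"
      by (intro VsD(1) alg.closed_diff resv_Vs alg.V_closed X Y)
    show "(resv (D (resv X) (resv Y)) - resv (D (resv Y) (resv X))) q = bracket A X Y q" if "q \<in> W" for q
      using that torsion_free[OF X Y that] by (auto simp: D_res X Y)
  qed (auto intro: VsD(1)[OF resv_Vs] Z)
  show ?thesis
    using p by (auto simp: alg.R_def alg.br_def curvature_def 1 2 X Y Z)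
qed

text \<open>Trace is independent of the basis: expanding the coordinate fields in the frame, and the
  values of \<open>T\<close> on the frame in coordinate vectors, gives the same double sum.
  \<open>W\<close> lies inside the chart so that the coordinate fields are smooth on all of
  \<open>W\<close>.\<close>

lemma trace_at_frame:
  assumes p: "p \<in> W" and W: "W \<subseteq> fst (SOME c. c \<in> A \<and> p \<in> fst c)"
    and res: "\<And>X. smooth_vfield_on A W X \<Longrightarrow> T (resv X) = T X"
    and tangent: "\<And>X. X \<in> Vs \<Longrightarrow> T X \<in> tangent_space A p"
    and add: "\<And>X Y. X \<in> Vs \<Longrightarrow> Y \<in> Vs \<Longrightarrow> T (X + Y) = T X + T Y"
    and scale: "\<And>X h. X \<in> Vs \<Longrightarrow> h \<in> Fs \<Longrightarrow> T (vf_scale h X) = (\<lambda>u. h p * T X u)"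
  shows "trace_at A p T = (\<Sum>a\<in>UNIV. g p (T (E a)) (E a p))"
proof -
  obtain U \<phi> where c: "(SOME c. c \<in> A \<and> p \<in> fst c) = (U, \<phi>)" by fastforce
  have U: "(U, \<phi>) \<in> A" "p \<in> U" using some_chart[of p] p W_points by (auto simp: c)
  let ?d = "coord_field A (U, \<phi>)"
  have d: "smooth_vfield_on A W (?d i)" for i
    using smooth_vfield_on_subset[OF smooth_vfield_on_coord[OF U(1)] W_open] W by (simp add: c)
  have Td: "T (?d i) u = (\<Sum>a\<in>UNIV. g p (?d i p) (E a p) * T (E a) u)" for i u
  proof -
    let ?h = "\<lambda>a. resf (\<lambda>p. g p (resv (?d i) p) (resv (E a) p))"
    have h: "?h a \<in> Fs" for a using resv_Vs[OF d] resv_Vs[OF E_smooth] by (rule alg.ip_closed)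
    have "T (?d i) = T (\<Sum>a\<in>UNIV. vf_scale (?h a) (resv (E a)))"
      using alg.frame[OF resv_Vs[OF d]] res[OF d] by simp
    also have "\<dots> = (\<Sum>a\<in>UNIV. T (vf_scale (?h a) (resv (E a))))"
      using h by (intro alg.additive_on_V(4) add) auto
    finally show ?thesis
      using p h by (simp add: sum_fun_apply scale res E_smooth)
  qed
  have "g p (T (E a)) (E a p) = (\<Sum>i\<in>UNIV. T (E a) (\<lambda>q. \<phi> q $ i) * g p (?d i p) (E a p))" for a
  proof -
    have t: "T (E a) \<in> tangent_space A p" using tangent[of "resv (E a)"] res[OF E_smooth] by simp
    have "T (E a) = (\<lambda>u. \<Sum>i\<in>UNIV. T (E a) (\<lambda>q. \<phi> q $ i) * ?d i p u)"
      using tangent_expand[OF U t] by (rule ext)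
    then have "g p (T (E a)) (E a p) = g p (\<lambda>u. \<Sum>i\<in>UNIV. T (E a) (\<lambda>q. \<phi> q $ i) * ?d i p u) (E a p)"
      by (rule arg_cong)
    also have "\<dots> = (\<Sum>i\<in>UNIV. T (E a) (\<lambda>q. \<phi> q $ i) * g p (?d i p) (E a p))"
      by (rule g_sum[OF E_tangent[OF p]]) (rule smooth_vfield_onD(3)[OF d p])
    finally show ?thesis .
  qed
  then have "(\<Sum>a\<in>UNIV. g p (T (E a)) (E a p)) = (\<Sum>a\<in>UNIV. \<Sum>i\<in>UNIV. g p (?d i p) (E a p) * T (E a) (\<lambda>q. \<phi> q $ i))"
    by (simp add: mult.commute)
  also have "\<dots> = (\<Sum>i\<in>UNIV. T (?d i) (\<lambda>q. \<phi> q $ i))"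
    unfolding Td by (rule sum.swap)
  finally show ?thesis by (simp add: trace_at_def Let_def c)
qed

text \<open>\<open>trace_at\<close> picks its chart by \<open>SOME\<close>; the domain of the frame
  is shrunk to fit into that chart.\<close>

lemma frame_at_chart:
  assumes "p \<in> W"
  obtains V where "p \<in> V" "V \<subseteq> W" "V \<subseteq> fst (SOME c. c \<in> A \<and> p \<in> fst c)" "levi_civita_frame A g D V E"
proof -
  let ?c = "SOME c. c \<in> A \<and> p \<in> fst c"
  have "p \<in> points A" using assms W_points by blast
  from some_chart[OF this] have c: "(fst ?c, snd ?c) \<in> A" "p \<in> fst ?c" by simp_all
  have "orthonormal_frame_on A g (W \<inter> fst ?c) E"
    using orthonormal chart_open[OF c(1)] W_open
    by (auto simp: orthonormal_frame_on_def intro: smooth_vfield_on_subset)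
  then have "levi_civita_frame A g D (W \<inter> fst ?c) E" by unfold_locales
  then show thesis using that[of "W \<inter> fst ?c"] assms c(2) by blast
qed

text \<open>The trace is evaluated in the calculus on a smaller set \<open>V\<close> inside the
  chart. At p the calculi on \<open>V\<close> and on \<open>W\<close> both compute
  \<open>curvature A D\<close>, so the result transfers.\<close>

lemma ricci_frame:
  assumes Y: "smooth_vfield_on A W Y" and Z: "smooth_vfield_on A W Z" and p: "p \<in> W"
  shows "alg.S (resv Y) (resv Z) p = ricci A D Y Z p"
proof -
  obtain V where V: "p \<in> V" "V \<subseteq> W" "V \<subseteq> fst (SOME c. c \<in> A \<and> p \<in> fst c)" and "levi_civita_frame A g D V E"
    using frame_at_chart[OF p] .
  then interpret V: levi_civita_frame A g D V E by simp
  have Y': "smooth_vfield_on A V Y" and Z': "smooth_vfield_on A V Z"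
    using Y Z V(2) V.W_open by (auto intro: smooth_vfield_on_subset)
  have T: "curvature A D X Y Z p = V.alg.R (V.resv X) (V.resv Y) (V.resv Z) p" if "smooth_vfield_on A V X" for X
    using V.curvature_res[OF that Y' Z' V(1)] by simp
  have idem: "V.resv X = X" if "X \<in> V.Vs" for X
    using that by (intro V.resv_eqI) (auto dest: V.VsD)
  have T': "curvature A D X Y Z p = V.alg.R X (V.resv Y) (V.resv Z) p" if "X \<in> V.Vs" for X
    using T[OF V.VsD(1)[OF that]] idem[OF that] by simp
  note Vs = V.resv_Vs[OF Y'] V.resv_Vs[OF Z']
  have "ricci A D Y Z p = (\<Sum>a\<in>UNIV. g p (curvature A D (E a) Y Z p) (E a p))"
    unfolding ricci_def
  proof (rule V.trace_at_frame[OF V(1,3)])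
    show "curvature A D (V.resv X) Y Z p = curvature A D X Y Z p" if "smooth_vfield_on A V X" for X
      using T[OF that] T'[OF V.resv_Vs[OF that]] by simp
    show "curvature A D X Y Z p \<in> tangent_space A p" if "X \<in> V.Vs" for X
      unfolding T'[OF that] by (intro V.VsD(3) V.alg.R_closed that Vs V(1))
    show "curvature A D (X + X') Y Z p = curvature A D X Y Z p + curvature A D X' Y Z p"
      if "X \<in> V.Vs" "X' \<in> V.Vs" for X X'
      using that by (simp add: T' V.alg.R_add1 Vs)
    show "curvature A D (vf_scale h X) Y Z p = (\<lambda>u. h p * curvature A D X Y Z p u)"
      if "X \<in> V.Vs" "h \<in> V.Fs" for X h
      using that by (simp add: T' V.alg.R_sc1 Vs) (simp add: vf_scale_def)
  qed
  then show ?thesis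
    using p by (simp add: alg.S_def sum_fun_apply curvature_res[OF E_smooth Y Z p])
qed

lemma divergence_frame:
  assumes Z: "smooth_vfield_on A W Z" and p: "p \<in> W"
  shows "divergence A D Z p = (\<Sum>a\<in>UNIV. g p (D (E a) Z p) (E a p))"
proof -
  obtain V where V: "p \<in> V" "V \<subseteq> W" "V \<subseteq> fst (SOME c. c \<in> A \<and> p \<in> fst c)" and "levi_civita_frame A g D V E"
    using frame_at_chart[OF p] .
  then interpret V: levi_civita_frame A g D V E by simp
  have Z': "smooth_vfield_on A V Z"
    using Z V(2) V.W_open by (auto intro: smooth_vfield_on_subset)
  show ?thesis unfolding divergence_def
  proof (rule V.trace_at_frame[OF V(1,3)])
    show "D (V.resv X) Z p = D X Z p" if "smooth_vfield_on A V X" for X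
      by (rule D_local[OF V.VsD(1)[OF V.resv_Vs[OF that]] that Z' Z' _ _ V(1)]) auto
    show "D X Z p \<in> tangent_space A p" if "X \<in> V.Vs" for X
      by (rule smooth_vfield_onD(3)[OF D_smooth[OF V.VsD(1)[OF that] Z'] V(1)])
    show "D (X + X') Z p = D X Z p + D X' Z p" if "X \<in> V.Vs" "X' \<in> V.Vs" for X X'
      using D_add1[OF V.VsD(1)[OF that(1)] V.VsD(1)[OF that(2)] Z' V(1)]
      by (simp add: vf_plus) (simp add: vf_add_def plus_fun_def)
    show "D (vf_scale h X) Z p = (\<lambda>u. h p * D X Z p u)" if "X \<in> V.Vs" "h \<in> V.Fs" for X h
      using D_scale1[OF V.VsD(1)[OF that(1)] Z' V.FsD(1)[OF that(2)] V(1)] by (simp add: vf_scale_def)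
  qed
qed

lemma dv_res:
  assumes Z: "smooth_vfield_on A W Z" and p: "p \<in> W"
  shows "alg.dv (resv Z) p = divergence A D Z p"
  using p by (simp add: alg.dv_def sum_fun_apply divergence_frame[OF assms] D_res[OF E_smooth Z])

section \<open>Hessian, Laplacian and Lie derivative for a gradient field\<close>

lemma hessian_eq:
  assumes "smooth_fun_on A W f" and X: "smooth_vfield_on A W X" and Y: "smooth_vfield_on A W Y" and p: "p \<in> W"
  shows "hessian D f X Y p = g p (D X (grad A g f) p) (Y p)"
proof -
  have \<xi>: "smooth_vfield_on A W (grad A g f)" by (rule grad_smooth[OF assms(1)])
  \<comment> \<open>On \<open>W\<close> the inner product with the gradient is Y(f). Differentiating
    it by metric compatibility gives the wanted term and one with \<open>D X Y\<close>, which the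
    definition of the Hessian subtracts.\<close>
  have "X p (\<lambda>q. g q (grad A g f q) (Y q)) = X p (\<lambda>q. Y q f)"
    by (rule tangent_cong[OF smooth_vfield_onD(3)[OF X p] W_open p])
       (use Y in \<open>simp add: grad_inner smooth_vfield_onD\<close>)
  then show ?thesis
    using metric_compat[OF X \<xi> Y p] grad_inner[OF p smooth_vfield_onD(3)[OF D_smooth[OF X Y] p]]
    by (simp add: hessian_def cov_deriv_form_def differential_def)
qed

text \<open>The two sides differ by [X, Y](f) minus the action of \<open>D X Y - D Y X\<close> on f,
  which is 0 by torsion-freeness.\<close>

lemma hessian_sym:
  assumes f: "smooth_fun_on A W f" and X: "smooth_vfield_on A W X" and Y: "smooth_vfield_on A W Y" and p: "p \<in> W"
  shows "hessian D f X Y p = hessian D f Y X p"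
  using torsion_free[OF X Y p, of f] smooth_nearI[OF f p]
  by (simp add: hessian_def cov_deriv_form_def differential_def bracket_def)

text \<open>Metric compatibility gives twice the Hessian on (X, \<xi>) for the derivative of the
  squared length along X; symmetry moves \<xi> into the differentiating slot.\<close>

lemma grad_norm_sq:
  assumes f: "smooth_fun_on A W f" and p: "p \<in> W"
  defines "\<xi> \<equiv> grad A g f"
  shows "grad A g (norm_sq g \<xi>) p = vf_scale (\<lambda>q. 2) (D \<xi> \<xi>) p"
    and "\<xi> p (norm_sq g \<xi>) = 2 * g p (D \<xi> \<xi> p) (\<xi> p)"
proof -
  have \<xi>: "smooth_vfield_on A W \<xi>" unfolding \<xi>_def by (rule grad_smooth[OF f])
  have D\<xi>: "D X \<xi> p \<in> tangent_space A p" if "smooth_vfield_on A W X" for X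
    by (rule smooth_vfield_onD(3)[OF D_smooth[OF that \<xi>] p])
  have *: "X p (norm_sq g \<xi>) = 2 * g p (D \<xi> \<xi> p) (X p)" if X: "smooth_vfield_on A W X" for X
  proof -
    have "X p (norm_sq g \<xi>) = g p (D X \<xi> p) (\<xi> p) + g p (\<xi> p) (D X \<xi> p)"
      using metric_compat[OF X \<xi> \<xi> p] by (simp add: norm_sq_def[abs_def])
    also have "g p (\<xi> p) (D X \<xi> p) = g p (D X \<xi> p) (\<xi> p)"
      by (rule g_sym[OF smooth_vfield_onD(3)[OF \<xi> p] D\<xi>[OF X]])
    also have "g p (D X \<xi> p) (\<xi> p) = g p (D \<xi> \<xi> p) (X p)"
      using hessian_eq[OF f X \<xi> p] hessian_eq[OF f \<xi> X p] hessian_sym[OF f X \<xi> p] by (simp add: \<xi>_def)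
    finally show ?thesis by simp
  qed
  show "\<xi> p (norm_sq g \<xi>) = 2 * g p (D \<xi> \<xi> p) (\<xi> p)" by (rule *[OF \<xi>])
  show "grad A g (norm_sq g \<xi>) p = vf_scale (\<lambda>q. 2) (D \<xi> \<xi>) p"
  proof (rule grad_eqI)
    show "vf_scale (\<lambda>q. 2) (D \<xi> \<xi>) p \<in> tangent_space A p"
      unfolding vf_scale_def by (rule tangent_scale[OF D\<xi>[OF \<xi>]])
    fix w assume w: "w \<in> tangent_space A p"
    \<comment> \<open>The gradient is tested on single vectors, while \<open>*\<close> speaks of
      fields: w is extended to a field on \<open>W\<close> with constant frame coefficients.\<close>
    define X where "X = (\<lambda>q u. \<Sum>a\<in>UNIV. g p w (E a p) * E a q u)"
    have "smooth_vfield_on A W X"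
      unfolding X_def by (intro smooth_vfield_on_sum W_open W_points E_smooth smooth_fun_on_const)
    moreover have "X p = w" unfolding X_def by (rule E_expand[OF p w, symmetric])
    ultimately show "g p (vf_scale (\<lambda>q. 2) (D \<xi> \<xi>) p) w = w (norm_sq g \<xi>)"
      using *[of X] g_scale[OF D\<xi>[OF \<xi>] w, of 2] by (simp add: vf_scale_def)
  qed
qed

lemma laplacian_norm_sq:
  assumes f: "smooth_fun_on A W f" and p: "p \<in> W"
  defines "\<xi> \<equiv> grad A g f"
  shows "laplacian A g D (norm_sq g \<xi>) p = 2 * divergence A D (D \<xi> \<xi>) p"
proof -
  have \<xi>: "smooth_vfield_on A W \<xi>" unfolding \<xi>_def by (rule grad_smooth[OF f])
  note D\<xi> = D_smooth[OF \<xi> \<xi>]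
  have two: "smooth_fun_on A W (\<lambda>q. 2)" by (rule smooth_fun_on_const[OF W_open W_points])
  have "smooth_fun_on A W (norm_sq g \<xi>)"
    using g_smooth[OF \<xi> \<xi>] by (simp add: norm_sq_def[abs_def])
  then have N: "smooth_vfield_on A W (grad A g (norm_sq g \<xi>))" by (rule grad_smooth)
  have "g p (D (E a) (grad A g (norm_sq g \<xi>)) p) (E a p) = 2 * g p (D (E a) (D \<xi> \<xi>) p) (E a p)" for a
  proof -
    have "D (E a) (grad A g (norm_sq g \<xi>)) p = D (E a) (vf_scale (\<lambda>q. 2) (D \<xi> \<xi>)) p"
      using grad_norm_sq(1)[OF f]
      by (intro D_local[OF E_smooth E_smooth N smooth_vfield_on_scale[OF D\<xi> two] _ _ p]) (auto simp: \<xi>_def)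
    also have "\<dots> = (\<lambda>u. 2 * D (E a) (D \<xi> \<xi>) p u)"
      using D_scale2[OF E_smooth D\<xi> two p] tangent_const[OF E_tangent[OF p]]
      by (simp add: vf_add_def vf_scale_def)
    finally show ?thesis
      using g_scale[OF smooth_vfield_onD(3)[OF D_smooth[OF E_smooth D\<xi>] p] E_tangent[OF p]] by simp
  qed
  then show ?thesis
    by (simp add: laplacian_def divergence_frame[OF N p] divergence_frame[OF D\<xi> p] sum_distrib_left)
qed

text \<open>With the brackets written through \<open>D\<close>, the derivatives along \<xi> cancel
  by metric compatibility. What remains is the Hessian on (X, Y) plus the Hessian on (Y, X).\<close>

lemma lie_deriv_metric_grad:
  assumes f: "smooth_fun_on A W f" and X: "smooth_vfield_on A W X" and Y: "smooth_vfield_on A W Y" and p: "p \<in> W"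
  shows "lie_deriv_metric A g (grad A g f) X Y p = 2 * hessian D f X Y p"
proof -
  let ?\<xi> = "grad A g f"
  have \<xi>: "smooth_vfield_on A W ?\<xi>" by (rule grad_smooth[OF f])
  have br: "bracket A ?\<xi> X p = (\<lambda>u. 1 * D ?\<xi> X p u + (- 1) * D X ?\<xi> p u)" if "smooth_vfield_on A W X" for X
    using torsion_free[OF \<xi> that p] by (simp add: fun_eq_iff)
  have t: "D ?\<xi> X p \<in> tangent_space A p" "D X ?\<xi> p \<in> tangent_space A p" "X p \<in> tangent_space A p"
    "bracket A ?\<xi> X p \<in> tangent_space A p"
    if "smooth_vfield_on A W X" for X
    using that \<xi> p by (auto intro!: smooth_vfield_onD(3)[of W] D_smooth bracket_smooth)
  have "g p (bracket A ?\<xi> X p) (Y p) = g p (D ?\<xi> X p) (Y p) - g p (D X ?\<xi> p) (Y p)"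
    unfolding br[OF X] using g_lincomb[OF t(1)[OF X] t(2)[OF X] t(3)[OF Y], of 1 "-1"] by simp
  moreover have "g p (X p) (bracket A ?\<xi> Y p) = g p (X p) (D ?\<xi> Y p) - g p (D Y ?\<xi> p) (X p)"
    using g_sym[OF t(3)[OF X] t(4)[OF Y]] g_lincomb[OF t(1)[OF Y] t(2)[OF Y] t(3)[OF X], of 1 "-1"]
      g_sym[OF t(3)[OF X] t(1)[OF Y]] br[OF Y] by simp
  ultimately show ?thesis
    using metric_compat[OF \<xi> X Y p] hessian_sym[OF f X Y p]
    by (simp add: lie_deriv_metric_def hessian_eq[OF f X Y p] hessian_eq[OF f Y X p])
qed

text \<open>The sum of squares keeps the frame \<open>E\<close> explicit, so that it can later be
  matched with the frame chosen in \<open>hessian_norm_sq\<close>.\<close>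

lemma soliton_formula:
  assumes f: "smooth_fun_on A W f" and soliton: "eta_ricci_soliton A g D (grad A g f) lam mu" and p: "p \<in> W"
  defines "\<xi> \<equiv> grad A g f"
  shows "1 / 2 * (laplacian A g D (norm_sq g \<xi>) p - \<xi> p (norm_sq g \<xi>)) =
    (\<Sum>i\<in>UNIV. \<Sum>j\<in>UNIV. (hessian D f (E i) (E j) p)\<^sup>2) + lam * norm_sq g \<xi> p
      + mu * norm_sq g \<xi> p * (norm_sq g \<xi> p - 2 * laplacian A g D f p)"
proof -
  have \<xi>: "smooth_vfield_on A W \<xi>" unfolding \<xi>_def by (rule grad_smooth[OF f])
  note \<xi>' = resv_Vs[OF \<xi>]
  have D\<xi>: "D X (resv \<xi>) q = D X \<xi> q" if "X \<in> Vs" "q \<in> W" for X q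
    by (rule D_local[OF VsD(1)[OF that(1)] VsD(1)[OF that(1)] VsD(1)[OF \<xi>'] \<xi> _ _ that(2)]) auto
  have hess: "g q (D X (resv \<xi>) q) (Y q) = hessian D f X Y q" if "X \<in> Vs" "Y \<in> Vs" "q \<in> W" for X Y q
    using hessian_eq[OF f VsD(1)[OF that(1)] VsD(1)[OF that(2)] that(3)] D\<xi>[OF that(1,3)] by (simp add: \<xi>_def)
  have const: "resf (\<lambda>q. k) \<in> Fs" for k
    by (intro resf_Fs smooth_fun_on_const W_open W_points)
  have const': "(\<lambda>q. X q (resf (\<lambda>q. k))) = 0" if "X \<in> Vs" for X k
  proof
    fix q show "X q (resf (\<lambda>q. k)) = (0 :: 'a \<Rightarrow> real) q"
    proof (cases "q \<in> W")
      case True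
      have "X q (resf (\<lambda>q. k)) = X q (\<lambda>q. k)"
        by (rule tangent_cong[OF VsD(3)[OF that True] W_open True]) simp
      then show ?thesis using tangent_const[OF VsD(3)[OF that True]] by simp
    qed (use that in \<open>simp add: VsD\<close>)
  qed
  interpret S: riemann_alg_soliton Fs Vs vf_scale "\<lambda>X h p. X p h" "\<lambda>X Y. resf (\<lambda>p. g p (X p) (Y p))"
    "\<lambda>X Y. resv (D X Y)" "\<lambda>a. resv (E a)" "resv \<xi>" "resf (\<lambda>q. lam)" "resf (\<lambda>q. mu)"
  proof
    show "resv \<xi> \<in> Vs" by (rule \<xi>')
    show "resf (\<lambda>q. lam) \<in> Fs" "resf (\<lambda>q. mu) \<in> Fs" by (rule const)+
    show "(\<lambda>q. X q (resf (\<lambda>q. lam))) = 0" "(\<lambda>q. X q (resf (\<lambda>q. mu))) = 0" if "X \<in> Vs" for X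
      by (rule const'[OF that])+
    fix X Y assume V: "X \<in> Vs" "Y \<in> Vs"
    show "resf (\<lambda>q. g q (resv (D X (resv \<xi>)) q) (Y q)) = resf (\<lambda>q. g q (resv (D Y (resv \<xi>)) q) (X q))"
      using V hessian_sym[OF f VsD(1) VsD(1), OF V] by (auto simp: resf_def fun_eq_iff hess)
    show "resf (\<lambda>q. g q (resv (D X (resv \<xi>)) q) (Y q)) + alg.S X Y
      + resf (\<lambda>q. lam) * resf (\<lambda>q. g q (X q) (Y q))
      + resf (\<lambda>q. mu) * (resf (\<lambda>q. g q (resv \<xi> q) (X q)) * resf (\<lambda>q. g q (resv \<xi> q) (Y q))) = 0"
    proof
      fix q
      show "(resf (\<lambda>q. g q (resv (D X (resv \<xi>)) q) (Y q)) + alg.S X Y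
        + resf (\<lambda>q. lam) * resf (\<lambda>q. g q (X q) (Y q))
        + resf (\<lambda>q. mu) * (resf (\<lambda>q. g q (resv \<xi> q) (X q)) * resf (\<lambda>q. g q (resv \<xi> q) (Y q)))) q
        = (0 :: 'a \<Rightarrow> real) q"
      proof (cases "q \<in> W")
        case True
        \<comment> \<open>Members of \<open>Vs\<close> are their own extensions, which brings the
          goal into the form of \<open>ricci_frame\<close>.\<close>
        have "resv X = X" "resv Y = Y" using V by (auto intro!: resv_eqI dest: VsD)
        then have "alg.S X Y q = ricci A D X Y q"
          using ricci_frame[OF VsD(1)[OF V(1)] VsD(1)[OF V(2)] True] by simp
        moreover have "lie_deriv_metric A g \<xi> X Y q + 2 * ricci A D X Y q + 2 * lam * g q (X q) (Y q)
            + 2 * mu * g q (\<xi> q) (X q) * g q (\<xi> q) (Y q) = 0"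
          using soliton VsD(1)[OF V(1)] VsD(1)[OF V(2)] True
          unfolding eta_ricci_soliton_def dual_form_def \<xi>_def by blast
        moreover have "lie_deriv_metric A g \<xi> X Y q = 2 * hessian D f X Y q"
          unfolding \<xi>_def by (rule lie_deriv_metric_grad[OF f VsD(1)[OF V(1)] VsD(1)[OF V(2)] True])
        ultimately show ?thesis using True V by (simp add: hess)
      next
        case False
        \<comment> \<open>Off \<open>W\<close> every summand is an extension by zero; for the Ricci
          term this is membership in \<open>Fs\<close>.\<close>
        have "alg.S X Y \<in> Fs" using V by simp
        then show ?thesis using False by (simp add: FsD)
      qed
    qed
  qed
  have HE: "g p (D (resv (E a)) (resv \<xi>) p) (E b p) = hessian D f (E a) (E b) p" for a b
    using hessian_eq[OF f E_smooth E_smooth p, of a b] D_res[OF E_smooth \<xi> p, of a] by (simp add: \<xi>_def)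
  have dv1: "alg.dv (resv (D (resv \<xi>) (resv \<xi>))) p = divergence A D (D \<xi> \<xi>) p"
  proof -
    have "resv (D (resv \<xi>) (resv \<xi>)) = resv (D \<xi> \<xi>)" using D_res[OF \<xi> \<xi>] by (intro resv_eqI) auto
    then show ?thesis using dv_res[OF D_smooth[OF \<xi> \<xi>] p] by simp
  qed
  have dv2: "alg.dv (resv \<xi>) p = laplacian A g D f p"
    using dv_res[OF \<xi> p] by (simp add: laplacian_def \<xi>_def)
  have "divergence A D (D \<xi> \<xi>) p - g p (D \<xi> \<xi> p) (\<xi> p)
      = (\<Sum>a\<in>UNIV. \<Sum>b\<in>UNIV. hessian D f (E a) (E b) p * hessian D f (E a) (E b) p) + lam * g p (\<xi> p) (\<xi> p)
        + mu * (g p (\<xi> p) (\<xi> p) * g p (\<xi> p) (\<xi> p))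
        - mu * (g p (\<xi> p) (\<xi> p) * laplacian A g D f p + g p (\<xi> p) (\<xi> p) * laplacian A g D f p)"
    using fun_cong[OF S.soliton_identity, of p] p
    by (simp add: dv1 dv2 sum_fun_apply HE D_res[OF \<xi> \<xi> p])
  moreover have "laplacian A g D (norm_sq g \<xi>) p = 2 * divergence A D (D \<xi> \<xi>) p"
    unfolding \<xi>_def by (rule laplacian_norm_sq[OF f p])
  moreover have "\<xi> p (norm_sq g \<xi>) = 2 * g p (D \<xi> \<xi> p) (\<xi> p)"
    unfolding \<xi>_def by (rule grad_norm_sq(2)[OF f p])
  ultimately show ?thesis
    by (simp add: norm_sq_def power2_eq_square algebra_simps)
qed

end

theorem theorem3p2:
  fixes A :: "('a::{t2_space,second_countable_topology}, 'm::finite) chart set"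
    and g :: "'a metric" and D :: "'a connection"
    and f :: "'a \<Rightarrow> real" and \<xi> :: "'a vfield" and lam mu :: real and p :: 'a
  assumes "smooth_atlas A"
    and "riemannian_metric A g"
    and "levi_civita A g D"
    and "smooth_fun_on A (points A) f"
    and "\<xi> = grad A g f"
    and "eta_ricci_soliton A g D \<xi> lam mu"
    and "p \<in> points A"
  shows "1 / 2 * (laplacian A g D (norm_sq g \<xi>) p - \<xi> p (norm_sq g \<xi>)) =
    hessian_norm_sq A g D f p + lam * norm_sq g \<xi> p
      + mu * norm_sq g \<xi> p * (norm_sq g \<xi> p - 2 * laplacian A g D f p)"
proof -
  interpret M: levi_civita_manifold A g D using assms(1-3) by unfold_locales
  \<comment> \<open>This is the very frame chosen inside \<open>hessian_norm_sq\<close>, so the sum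
    of squares over \<open>E\<close> is its value by definition.\<close>
  define E where "E = (SOME E. \<exists>W. p \<in> W \<and> orthonormal_frame_on A g W E)"
  obtain W where p: "p \<in> W" and W: "orthonormal_frame_on A g W E"
    using someI_ex[OF M.orthonormal_frame_exists[OF assms(7)]] unfolding E_def by blast
  interpret L: levi_civita_frame A g D W E using W by unfold_locales
  have "smooth_fun_on A W f"
    by (rule M.smooth_fun_on_subset[OF assms(4) L.W_open L.W_points])
  from L.soliton_formula[OF this _ p] show ?thesis
    using assms(6) unfolding assms(5) hessian_norm_sq_def Let_def E_def by blast
qed

end
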